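(* Let $N\ge2$, let $\omega\subset\mathbb R^{N-1}$ be a smooth bounded domain and let $\mathcal C_\omega=\omega\times(0,+\infty)\subset\mathbb R^N$ be the cylinder spanned by $\omega$. Let $\varphi\in C^2(\overline\omega)$ be a positive function and let $\Omega_\varphi=\{(x',x_N):\ x'\in\omega,\ 0<x_N<\varphi(x')\}\subset\mathcal C_\omega$. Assume that $|\nabla\varphi|\ge\delta$ on $\overline\omega$ for some $\delta>0$. Then $\Omega_\varphi$ cannot be self-Cheeger relative to $\mathcal C_\omega$.
   Context: For an unbounded Lipschitz domain $\mathcal C\subset\mathbb R^N$ and a set $E\subset\mathcal C$, the relative perimeter is $P_{\mathcal C}(E)=\sup\{\int_E\operatorname{div}\psi\,dx:\psi\in C_c^1(\mathcal C,\mathbb R^N),\|\psi\|_\infty\le1\}$, which equals the $(N-1)$-dimensional Hausdorff measure of $\partial E\cap\mathcal C$ if $\partial E\cap\mathcal C$ is Lipschitz. $|E|$ is the Lebesgue measure. The relative Cheeger constant of $\Omega\subseteq\mathcal C$ is $h_{\mathcal C}(\Omega)=\inf_{E\subseteq\Omega}P_{\mathcal C}(E)/|E|$ (over measurable $E\subseteq\Omega$ with $|E|>0$). $\Omega$ is self-Cheeger relative to $\mathcal C$ if $P_{\mathcal C}(\Omega)/|\Omega|=h_{\mathcal C}(\Omega)$. *)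

theory Defs
  imports "HOL-Analysis.Analysis"
begin

section \<open>Functions of class \<open>C\<^sup>k\<close>\<close>

primrec dir_derivs :: "'a::euclidean_space list \<Rightarrow> ('a \<Rightarrow> 'b::euclidean_space) \<Rightarrow> 'a \<Rightarrow> 'b" where
  "dir_derivs [] f = f"
| "dir_derivs (v # vs) f = (\<lambda>x. frechet_derivative (dir_derivs vs f) (at x) v)"

text \<open>Meant for open \<open>S\<close>, since derivatives are taken in full neighbourhoods.\<close>

definition Ck_on :: "nat \<Rightarrow> 'a::euclidean_space set \<Rightarrow> ('a \<Rightarrow> 'b::euclidean_space) \<Rightarrow> bool" where
  "Ck_on k S f \<longleftrightarrow>
     (\<forall>vs. length vs < k \<longrightarrow> (\<forall>x\<in>S. dir_derivs vs f differentiable (at x))) \<and>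
     (\<forall>vs. length vs \<le> k \<longrightarrow> continuous_on S (dir_derivs vs f))"

text \<open>The space \<open>C\<^sup>k\<close> of the closure of an open set \<open>S\<close>: all derivatives of order at most \<open>k\<close>
  extend continuously from \<open>S\<close> to its closure, and \<open>f\<close> is itself its own extension.\<close>

definition Ck_closure :: "nat \<Rightarrow> 'a::euclidean_space set \<Rightarrow> ('a \<Rightarrow> 'b::euclidean_space) \<Rightarrow> bool" where
  "Ck_closure k S f \<longleftrightarrow>
     Ck_on k S f \<and> continuous_on (closure S) f \<and>
     (\<forall>vs. length vs \<le> k \<longrightarrow>
        (\<exists>g. continuous_on (closure S) g \<and> (\<forall>x\<in>S. g x = dir_derivs vs f x)))"

definition grad :: "('a::euclidean_space \<Rightarrow> real) \<Rightarrow> 'a \<Rightarrow> 'a" where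
  "grad f x = (\<Sum>b\<in>Basis. frechet_derivative f (at x) b *\<^sub>R b)"

text \<open>The continuous extension of the gradient to the closure of an open set \<open>S\<close>. It depends only
  on the values of \<open>f\<close> in \<open>S\<close>, and for \<open>Ck_closure 1 S f\<close> the limit exists at every point of the
  closure and equals \<open>grad f x\<close> for \<open>x \<in> S\<close>.\<close>

definition closure_grad :: "'a::euclidean_space set \<Rightarrow> ('a \<Rightarrow> real) \<Rightarrow> 'a \<Rightarrow> 'a" where
  "closure_grad S f x = Lim (at x within S) (grad f)"

definition divergence :: "('a::euclidean_space \<Rightarrow> 'a) \<Rightarrow> 'a \<Rightarrow> real" where
  "divergence \<psi> x = (\<Sum>b\<in>Basis. frechet_derivative \<psi> (at x) b \<bullet> b)"


section \<open>Smooth bounded domains\<close>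

text \<open>Near each boundary point \<open>S\<close> is the strict epigraph of a smooth function after a rotation of
  the coordinates. The unit vector \<open>\<nu>\<close> is the vertical direction, and \<open>\<gamma>\<close> is only ever evaluated
  on the hyperplane orthogonal to \<open>\<nu>\<close>; in dimension one this hyperplane is a point.\<close>

definition smooth_boundary :: "'a::euclidean_space set \<Rightarrow> bool" where
  "smooth_boundary S \<longleftrightarrow>
     (\<forall>p\<in>frontier S. \<exists>r>0. \<exists>\<nu> (\<gamma> :: 'a \<Rightarrow> real).
        norm \<nu> = 1 \<and> (\<forall>k. Ck_on k UNIV \<gamma>) \<and>
        S \<inter> ball p r = {x \<in> ball p r. x \<bullet> \<nu> > \<gamma> (x - (x \<bullet> \<nu>) *\<^sub>R \<nu>)})"

definition smooth_bounded_domain :: "'a::euclidean_space set \<Rightarrow> bool" where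
  "smooth_bounded_domain S \<longleftrightarrow>
     open S \<and> connected S \<and> S \<noteq> {} \<and> bounded S \<and> smooth_boundary S"


section \<open>Relative perimeter and relative Cheeger constant\<close>

text \<open>For open \<open>C\<close>, fields in \<open>C\<^sub>c\<^sup>1(C)\<close> are identified with their extensions by zero
  to the whole space.\<close>

definition test_fields :: "'a::euclidean_space set \<Rightarrow> ('a \<Rightarrow> 'a) set" where
  "test_fields C = {\<psi>. Ck_on 1 UNIV \<psi> \<and>
     compact (closure {x. \<psi> x \<noteq> 0}) \<and> closure {x. \<psi> x \<noteq> 0} \<subseteq> C \<and> (\<forall>x. norm (\<psi> x) \<le> 1)}"

definition rel_perimeter :: "'a::euclidean_space set \<Rightarrow> 'a set \<Rightarrow> ereal" where
  "rel_perimeter C E = (SUP \<psi>\<in>test_fields C. ereal (LINT x:E|lebesgue. divergence \<psi> x))"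

text \<open>In \<open>ereal\<close> the junk value \<open>\<infinity> / \<infinity> = 0\<close> can only occur for sets \<open>E\<close> of infinite measure.\<close>

definition cheeger_quotient :: "'a::euclidean_space set \<Rightarrow> 'a set \<Rightarrow> ereal" where
  "cheeger_quotient C E = rel_perimeter C E / enn2ereal (emeasure lebesgue E)"

definition rel_cheeger_constant :: "'a::euclidean_space set \<Rightarrow> 'a set \<Rightarrow> ereal" where
  "rel_cheeger_constant C \<Omega> =
     (INF E\<in>{E. E \<subseteq> \<Omega> \<and> E \<in> sets lebesgue \<and> emeasure lebesgue E > 0}. cheeger_quotient C E)"

definition self_cheeger :: "'a::euclidean_space set \<Rightarrow> 'a set \<Rightarrow> bool" where
  "self_cheeger C \<Omega> \<longleftrightarrow> cheeger_quotient C \<Omega> = rel_cheeger_constant C \<Omega>"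


section \<open>Cylinders and cartesian domains\<close>

definition cylinder :: "'a::euclidean_space set \<Rightarrow> ('a \<times> real) set" where
  "cylinder \<omega> = \<omega> \<times> {0<..}"

definition subgraph :: "'a::euclidean_space set \<Rightarrow> ('a \<Rightarrow> real) \<Rightarrow> ('a \<times> real) set" where
  "subgraph \<omega> \<phi> = {(x, t). x \<in> \<omega> \<and> 0 < t \<and> t < \<phi> x}"

end

theory Submission
  imports Defs "HOL-Analysis.Analysis"
begin

text \<open>Let \<open>M = sup \<phi>\<close>. For small \<open>\<epsilon>\<close>, flatten the graph near the top: put \<open>l = max 0 (\<phi> - (M - \<epsilon>)) / \<epsilon>\<close>
  and \<open>g = \<phi> - \<epsilon> l\<^sup>2 / 2\<close>, so that \<open>\<nabla>g = (1 - l) \<nabla>\<phi>\<close>. Convexity of the area integrand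
  \<open>p \<mapsto> \<surd>(1 + |p|\<^sup>2)\<close> and \<open>|\<nabla>\<phi>| \<ge> \<delta>\<close> give a perimeter gain of at least
  \<open>(\<surd>(1 + \<delta>\<^sup>2) - 1) \<integral>l\<close>, while the loss of volume is at most \<open>\<epsilon>/2 \<integral>l\<close>, and \<open>\<integral>l > 0\<close>.
  For \<open>\<epsilon>\<close> small enough the Cheeger quotient of the subgraph of \<open>g\<close> is strictly smaller.

  The relative perimeter of a subgraph is the area of the graph by the divergence formula
  \<open>\<integral>\<^bsub>t < g(x)\<^esub> div \<psi> = \<integral>\<^bsub>\<omega>\<^esub> \<psi>(x, g x) \<bullet> (-\<nabla>g, 1)\<close>.\<close>

section \<open>Compactly supported functions: extension by zero and vanishing integrals of
  derivatives\<close>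

lemma integrable_bounded_support:
  fixes f :: "'a::euclidean_space \<Rightarrow> 'b::euclidean_space"
  assumes "f \<in> borel_measurable borel" "\<And>x. norm (f x) \<le> B" "bounded S" "\<And>x. x \<notin> S \<Longrightarrow> f x = 0"
  shows "integrable lborel f"
proof -
  obtain r where r: "S \<subseteq> cball 0 r" using \<open>bounded S\<close> unfolding bounded_iff by (auto simp: subset_eq)
  have B: "norm (f x) \<le> \<bar>B\<bar>" for x using assms(2)[of x] by linarith
  have i: "integrable lborel (\<lambda>x. indicator (cball (0::'a) r) x *\<^sub>R B)"
    using emeasure_bounded_finite[of "cball (0::'a) r"]
    by (intro integrable_scaleR_left) (auto simp: integrable_indicator_iff)
  have "norm (f x) \<le> norm (indicator (cball (0::'a) r) x *\<^sub>R B)" for x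
    using assms(4)[of x] r B[of x] by (cases "x \<in> S") (auto simp: indicator_def)
  then show ?thesis
    using assms(1) by (intro Bochner_Integration.integrable_bound[OF i] AE_I2) auto
qed

lemma continuous_compact_support_bounded:
  fixes f :: "'a::euclidean_space \<Rightarrow> 'b::euclidean_space"
  assumes "continuous_on UNIV f" "compact K" "\<And>x. x \<notin> K \<Longrightarrow> f x = 0"
  shows "\<exists>B\<ge>0. \<forall>x. norm (f x) \<le> B"
proof -
  have "compact (f ` K)"
    using assms(1,2) by (intro compact_continuous_image continuous_on_subset[OF assms(1)]) auto
  then have "bounded (f ` K)" by (rule compact_imp_bounded)
  then obtain B where B: "\<forall>y\<in>f ` K. norm y \<le> B"
    unfolding bounded_iff by auto
  have "norm (f x) \<le> max B 0" for x
    using B assms(3)[of x] by (cases "x \<in> K") auto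
  then show ?thesis by (intro exI[of _ "max B 0"]) auto
qed

text \<open>The open sets \<open>U\<close> and \<open>- K\<close> cover the space. On
  \<open>- K\<close> the function is locally zero, so by uniqueness of derivatives \<open>f'\<close>
  vanishes on the overlap, and the two continuous pieces glue together.\<close>

lemma zero_extension_C1:
  fixes f :: "'a::euclidean_space \<Rightarrow> 'b::euclidean_space"
  assumes U: "open U" and K: "compact K" "K \<subseteq> U"
    and f': "\<And>x. x \<in> U \<Longrightarrow> (f has_derivative f' x) (at x)"
    and cont: "\<And>v. continuous_on U (\<lambda>x. f' x v)"
    and zero: "\<And>x. x \<notin> K \<Longrightarrow> f x = 0"
  shows "(f has_derivative (if x \<in> U then f' x else (\<lambda>v. 0))) (at x)"
    and "continuous_on UNIV (\<lambda>x. (if x \<in> U then f' x else (\<lambda>v. 0)) v)"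
    and "x \<notin> K \<Longrightarrow> x \<in> U \<Longrightarrow> f' x v = 0"
proof -
  have oK: "open (- K)" using K compact_imp_closed by auto
  have z: "(f has_derivative (\<lambda>v. 0)) (at x)" if "x \<notin> K" for x
    by (rule has_derivative_transform_within_open[OF _ oK, of "\<lambda>x. 0"]) (use that zero in auto)
  then have z': "f' x v = 0" if "x \<notin> K" "x \<in> U" for x v
    using f'[OF that(2)] has_derivative_unique that(1) by metis
  show "x \<notin> K \<Longrightarrow> x \<in> U \<Longrightarrow> f' x v = 0" using z' by auto
  show "(f has_derivative (if x \<in> U then f' x else (\<lambda>v. 0))) (at x)"
    using z f' K by auto
  have "continuous_on U (\<lambda>x. (if x \<in> U then f' x else (\<lambda>v. 0)) v)"
    using cont[of v] by (rule continuous_on_eq) auto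
  moreover have "continuous_on (-K) (\<lambda>x. (if x \<in> U then f' x else (\<lambda>v. 0)) v)"
    by (rule continuous_on_eq[of _ "\<lambda>x. 0"]) (use z' in auto)
  ultimately have "continuous_on (U \<union> -K) (\<lambda>x. (if x \<in> U then f' x else (\<lambda>v. 0)) v)"
    using U oK continuous_on_open_Un by blast
  moreover have "U \<union> -K = UNIV" using K by auto
  ultimately show "continuous_on UNIV (\<lambda>x. (if x \<in> U then f' x else (\<lambda>v. 0)) v)" by simp
qed

lemma integral_translate:
  fixes f :: "'a::euclidean_space \<Rightarrow> real"
  assumes "f \<in> borel_measurable borel"
  shows "(LINT x|lborel. f (c + x)) = (LINT x|lborel. f x)"
proof -
  have "(LINT x|lborel. f x) = (LINT x|distr lborel borel ((+) c). f x)"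
    by (simp add: lborel_distr_plus)
  also have "\<dots> = (LINT x|lborel. f (c + x))"
    using assms by (subst integral_distr) auto
  finally show ?thesis by simp
qed

text \<open>Every difference quotient of \<open>f\<close> along \<open>v\<close> has integral zero
  by translation invariance of Lebesgue measure. Dominated convergence carries this over to the
  derivative, without iterated integrals or a choice of coordinates.\<close>

lemma integral_directional_derivative_eq_0:
  fixes f :: "'a::euclidean_space \<Rightarrow> real"
  assumes K: "compact K"
    and f': "\<And>x. (f has_derivative f' x) (at x)"
    and cont: "continuous_on UNIV (\<lambda>x. f' x v)"
    and zero: "\<And>x. x \<notin> K \<Longrightarrow> f x = 0"
  shows "(LINT x|lborel. f' x v) = 0"
proof -
  have fc: "continuous_on UNIV f"
    by (intro continuous_at_imp_continuous_on ballI has_derivative_continuous[OF f'])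
  have z': "f' x v = 0" if "x \<notin> K" for x
  proof -
    have oK: "open (- K)" using K compact_imp_closed by auto
    have "(f has_derivative (\<lambda>v. 0)) (at x)"
      by (rule has_derivative_transform_within_open[OF _ oK, of "\<lambda>x. 0"]) (use that zero in auto)
    then show ?thesis using f' has_derivative_unique by metis
  qed
  have "\<exists>B\<ge>0. \<forall>x. norm (f' x v) \<le> B"
    by (rule continuous_compact_support_bounded[OF cont K]) (rule z')
  then obtain B where B: "B \<ge> 0" "\<And>x. norm (f' x v) \<le> B" by auto
  obtain r where r: "K \<subseteq> cball 0 r"
    using compact_imp_bounded[OF K] unfolding bounded_iff by (auto simp: subset_eq)
  define q where "q n x = real (Suc n) * (f (x + (1 / real (Suc n)) *\<^sub>R v) - f x)" for n x
  \<comment> \<open>The radius is enlarged by \<open>norm v\<close> because the steps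
    \<open>1 / Suc n\<close> are at most 1: outside the larger ball both values of \<open>f\<close>
    in the quotient vanish. Inside it the mean value theorem bounds the quotient by
    \<open>B\<close>.\<close>
  define w where "w x = indicator (cball (0::'a) (r + norm v)) x * B" for x
  have fm: "f \<in> borel_measurable borel" using fc borel_measurable_continuous_onI by blast
  have wi: "integrable lborel w"
    unfolding w_def using emeasure_bounded_finite[of "cball (0::'a) (r + norm v)"]
    by (intro integrable_mult_left) (auto simp: integrable_indicator_iff)
  have path: "((\<lambda>s. f (x + s *\<^sub>R v)) has_field_derivative f' (x + s *\<^sub>R v) v) (at s)" for x s
  proof -
    have lin: "f' (x + s *\<^sub>R v) (h *\<^sub>R v) = f' (x + s *\<^sub>R v) v * h" for h
      using f'[of "x + s *\<^sub>R v"] has_derivative_linear linear_scale by fastforce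
    have "((\<lambda>s. f (x + s *\<^sub>R v)) has_derivative (\<lambda>h. f' (x + s *\<^sub>R v) (h *\<^sub>R v))) (at s)"
      by (rule has_derivative_compose[OF _ f']) (auto intro!: derivative_eq_intros)
    then show ?thesis unfolding has_field_derivative_def lin by simp
  qed
  have qb: "norm (q n x) \<le> w x" for n x
  proof (cases "x \<in> cball 0 (r + norm v)")
    case True
    obtain \<xi> where "f (x + (1 / real (Suc n)) *\<^sub>R v) - f (x + 0 *\<^sub>R v) = (1 / real (Suc n) - 0) * f' (x + \<xi> *\<^sub>R v) v"
      using MVT2[of 0 "1 / real (Suc n)" "\<lambda>s. f (x + s *\<^sub>R v)" "\<lambda>s. f' (x + s *\<^sub>R v) v"] path by auto
    then have "q n x = f' (x + \<xi> *\<^sub>R v) v" unfolding q_def by (simp add: field_simps)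
    then show ?thesis using B True unfolding w_def by auto
  next
    case False
    then have "norm x > r" using norm_ge_zero[of v] by (auto simp del: norm_ge_zero)
    then have 1: "x \<notin> K" using r by auto
    have "1 / real (Suc n) * norm v \<le> 1 * norm v" by (intro mult_right_mono) auto
    then have "norm ((1 / real (Suc n)) *\<^sub>R v) \<le> norm v" by (simp only: norm_scaleR) simp
    then have "norm (x + (1 / real (Suc n)) *\<^sub>R v) > r"
      using False norm_diff_ineq[of x "(1 / real (Suc n)) *\<^sub>R v"] by (auto simp del: norm_scaleR)
    then have "x + (1 / real (Suc n)) *\<^sub>R v \<notin> K" using r by (meson mem_cball_0 not_le subsetD)
    then show ?thesis using 1 B zero unfolding q_def w_def by auto
  qed
  have lim: "(\<lambda>n. q n x) \<longlonglongrightarrow> f' x v" for x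
  proof -
    have "(\<lambda>h. (f (x + h *\<^sub>R v) - f x) / h) \<midarrow>0\<rightarrow> f' x v"
      using path[of x 0] unfolding DERIV_def by simp
    moreover have "filterlim (\<lambda>n. 1 / real (Suc n)) (at 0) sequentially"
      using LIMSEQ_inverse_real_of_nat by (auto simp: filterlim_at inverse_eq_divide)
    ultimately have "(\<lambda>n. (f (x + (1 / real (Suc n)) *\<^sub>R v) - f x) / (1 / real (Suc n))) \<longlonglongrightarrow> f' x v"
      by (rule filterlim_compose)
    then show ?thesis unfolding q_def by (simp add: mult.commute)
  qed
  have qm: "q n \<in> borel_measurable borel" for n
    unfolding q_def by (intro borel_measurable_continuous_onI continuous_intros continuous_on_compose2[OF fc]) auto
  have "(\<lambda>n. LINT x|lborel. q n x) \<longlonglongrightarrow> (LINT x|lborel. f' x v)"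
    by (rule integral_dominated_convergence[OF _ _ wi])
      (use qm qb lim borel_measurable_continuous_onI[OF cont] in auto)
  moreover have "(LINT x|lborel. q n x) = 0" for n
  proof -
    have "\<exists>B\<ge>0. \<forall>x. norm (f x) \<le> B"
      by (rule continuous_compact_support_bounded[OF fc K]) (rule zero)
    then obtain Bf where Bf: "\<And>x. norm (f x) \<le> Bf" by auto
    have fi: "integrable lborel f"
      by (rule integrable_bounded_support[OF fm Bf compact_imp_bounded[OF K] zero])
    define c where "c = (1 / real (Suc n)) *\<^sub>R v"
    have fti: "integrable lborel (\<lambda>x. f (c + x))"
      using fi fm by (subst (asm) lborel_distr_plus[of c, symmetric]) (simp add: integrable_distr_eq)
    have "(LINT x|lborel. q n x) = real (Suc n) * ((LINT x|lborel. f (c + x)) - (LINT x|lborel. f x))"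
      unfolding q_def c_def[symmetric] add.commute[of _ c]
      by (simp only: integral_mult_right_zero Bochner_Integration.integral_diff[OF fti fi])
    then show ?thesis using integral_translate[OF fm, of c] by simp
  qed
  ultimately show ?thesis by (simp add: LIMSEQ_const_iff)
qed

text \<open>The basis of the product splits into the horizontal vectors \<open>(b, 0)\<close> and
  the single vertical vector \<open>(0, 1)\<close>.\<close>

lemma divergence_prod:
  fixes \<psi> :: "'a::euclidean_space \<times> real \<Rightarrow> 'a \<times> real"
  assumes D: "(\<psi> has_derivative D) (at z)"
  shows "divergence \<psi> z = (\<Sum>b\<in>Basis. fst (D (b, 0)) \<bullet> b) + snd (D (0, 1))"
proof -
  have "inj_on (\<lambda>u. (u::'a, 0::real)) Basis" "inj_on (\<lambda>u. (0::'a, u::real)) Basis"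
    by (auto intro!: inj_onI Pair_inject)
  then have "(\<Sum>i\<in>Basis. D i \<bullet> i) = (\<Sum>b\<in>Basis. D (b, 0) \<bullet> (b, 0)) + (\<Sum>b\<in>Basis. D (0, b) \<bullet> (0, b))"
    unfolding Basis_prod_def
    by (subst sum.union_disjoint) (auto simp: Basis_prod_def sum.reindex)
  then show ?thesis
    unfolding divergence_def frechet_derivative_at[OF D, symmetric] by (simp add: inner_Pair_0)
qed

section \<open>The divergence formula on the subgraph of a bounded C^1 function\<close>

text \<open>The locale is instantiated both with \<open>\<phi>\<close> and with its flattened
  version, whose gradient \<open>(1 - l) *\<^sub>R G\<close> is continuous but may have kinks. The
  field \<open>G\<close> is the gradient of \<open>g\<close>; the bounds \<open>M\<close> and
  \<open>L\<close> make the integrals over the bounded base finite.\<close>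

locale bounded_C1_graph =
  fixes \<omega> :: "'a::euclidean_space set" and g :: "'a \<Rightarrow> real" and G :: "'a \<Rightarrow> 'a" and M L :: real
  assumes op: "open \<omega>" and bd: "bounded \<omega>"
    and g': "\<And>x. x \<in> \<omega> \<Longrightarrow> (g has_derivative (\<lambda>v. G x \<bullet> v)) (at x)"
    and contG: "continuous_on \<omega> G"
    and gM: "\<And>x. x \<in> \<omega> \<Longrightarrow> g x \<le> M"
    and GL: "\<And>x. x \<in> \<omega> \<Longrightarrow> norm (G x) \<le> L"
begin

lemma cont_g: "continuous_on \<omega> g"
  by (intro continuous_at_imp_continuous_on ballI has_derivative_continuous[OF g'])

lemma open_subgraph: "open (subgraph \<omega> g)"
proof -
  have "open ((\<omega> \<times> {0<..}) \<inter> (\<lambda>z. g (fst z) - snd z) -` {0<..})"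
    by (intro continuous_open_preimage continuous_intros continuous_on_compose2[OF cont_g] open_Times op) auto
  also have "(\<omega> \<times> {0<..}) \<inter> (\<lambda>z. g (fst z) - snd z) -` {0<..} = subgraph \<omega> g"
    by (auto simp: subgraph_def)
  finally show ?thesis .
qed

lemma integrable_over_base:
  fixes f :: "'a \<Rightarrow> real"
  assumes c: "continuous_on \<omega> f" and b: "\<And>x. x \<in> \<omega> \<Longrightarrow> norm (f x) \<le> B"
  shows "integrable lborel (\<lambda>x. indicator \<omega> x * f x)"
proof (rule integrable_bounded_support[where S = \<omega>])
  from borel_measurable_continuous_on_indicator[OF _ c]
  show "(\<lambda>x. indicator \<omega> x * f x) \<in> borel_measurable borel" using op by auto
  show "norm (indicator \<omega> x * f x) \<le> \<bar>B\<bar>" for x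
    using b[of x] by (auto simp: indicator_def)
qed (use bd in auto)

context
  fixes K and \<psi> :: "'a \<times> real \<Rightarrow> 'a \<times> real" and D
  assumes K: "compact K" "K \<subseteq> cylinder \<omega>"
    and \<psi>': "\<And>z. (\<psi> has_derivative D z) (at z)"
    and contD: "\<And>v. continuous_on UNIV (\<lambda>z. D z v)"
    and zero: "\<And>z. z \<notin> K \<Longrightarrow> \<psi> z = 0"
begin

lemma cont_slice: "continuous_on \<omega> (\<lambda>x. D (x, g x - s) v)"
  by (intro continuous_on_compose2[OF contD] continuous_intros cont_g) auto

lemma cont_shear: "continuous_on (\<omega> \<times> S) (\<lambda>z. D (fst z, g (fst z) - snd z) v)"
  by (intro continuous_on_compose2[OF contD] continuous_intros continuous_on_compose2[OF cont_g]) auto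

lemma D_outside: "z \<notin> K \<Longrightarrow> D z v = 0"
  using zero_extension_C1(3)[of UNIV K \<psi> D z v, OF _ K(1) _ \<psi>' contD zero] by auto

lemma D_bounded: "\<exists>B\<ge>0. \<forall>z. norm (D z v) \<le> B"
  by (rule continuous_compact_support_bounded[OF contD K(1)]) (rule D_outside)

text \<open>By the chain rule the integrand is the derivative in direction \<open>b\<close> of the
  map sending \<open>x\<close> to \<open>fst (\<psi> (x, g x - s)) \<bullet> b\<close>. This map
  vanishes outside the projection of \<open>K\<close>, a compact subset of \<open>\<omega>\<close>,
  so its extension by zero is C^1 and no boundary term appears.\<close>

lemma horizontal_slice:
  fixes b :: 'a
  shows "(LINT x|lborel. indicator \<omega> x *
    (fst (D (x, g x - s) (b, 0)) \<bullet> b + (G x \<bullet> b) * (fst (D (x, g x - s) (0, 1)) \<bullet> b))) = 0"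
    (is "integral\<^sup>L lborel ?h = 0")
    and "integrable lborel (\<lambda>x. indicator \<omega> x *
    (fst (D (x, g x - s) (b, 0)) \<bullet> b + (G x \<bullet> b) * (fst (D (x, g x - s) (0, 1)) \<bullet> b)))"
proof -
  define f where "f x = (if x \<in> \<omega> then fst (\<psi> (x, g x - s)) \<bullet> b else 0)" for x
  define f' where "f' x v = fst (D (x, g x - s) (v, G x \<bullet> v)) \<bullet> b" for x v
  have K0: "compact (fst ` K)" "fst ` K \<subseteq> \<omega>"
    using K by (auto intro!: compact_continuous_image continuous_intros simp: cylinder_def)
  have D0: "D z (v, c) = D z (v, 0) + c *\<^sub>R D z (0, 1)" for z v c
  proof -
    have l: "linear (D z)" using \<psi>' has_derivative_linear by blast
    have "D z (v, c) = D z ((v, 0) + c *\<^sub>R (0, 1))" by simp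
    then show ?thesis using linear_add[OF l] linear_scale[OF l] by metis
  qed
  have der: "(f has_derivative f' x) (at x)" if "x \<in> \<omega>" for x
  proof -
    have "((\<lambda>x. (x, g x - s)) has_derivative (\<lambda>v. (v, G x \<bullet> v))) (at x)"
      by (auto intro!: derivative_eq_intros g' that)
    from has_derivative_compose[OF this \<psi>']
    have "((\<lambda>x. fst (\<psi> (x, g x - s)) \<bullet> b) has_derivative f' x) (at x)"
      unfolding f'_def by (intro has_derivative_inner_left has_derivative_fst)
    then show ?thesis
      by (rule has_derivative_transform_within_open[OF _ op that]) (simp add: f_def)
  qed
  have cont: "continuous_on \<omega> (\<lambda>x. f' x v)" for v
    unfolding f'_def D0[of _ v "G x \<bullet> v" for x] by (intro continuous_intros cont_slice contG)
  have z: "f x = 0" if "x \<notin> fst ` K" for x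
    using zero[of "(x, g x - s)"] that by (force simp: f_def)
  note ext = zero_extension_C1[OF op K0 der cont z]
  have "(LINT x|lborel. (if x \<in> \<omega> then f' x else (\<lambda>v. 0)) b) = 0"
    by (rule integral_directional_derivative_eq_0[OF K0(1) ext(1) ext(2)]) (assumption | erule z)+
  moreover have eq: "(if x \<in> \<omega> then f' x else (\<lambda>v. 0)) b = ?h x" for x
    using D0[of "(x, g x - s)" b "G x \<bullet> b"] by (auto simp: f'_def inner_add_left)
  ultimately show "integral\<^sup>L lborel ?h = 0" by simp
  have c: "continuous_on UNIV ?h" using ext(2)[of b] unfolding eq by simp
  have 0: "?h x = 0" if "x \<notin> fst ` K" for x
    using ext(3)[OF _ _ that, of b] unfolding eq[symmetric] by auto
  have "\<exists>B\<ge>0. \<forall>x. norm (?h x) \<le> B"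
    by (rule continuous_compact_support_bounded[OF c K0(1)]) (rule 0)
  then obtain B where "\<And>x. norm (?h x) \<le> B" by auto
  then show "integrable lborel ?h"
    by (rule integrable_bounded_support[OF borel_measurable_continuous_onI[OF c] _ compact_imp_bounded[OF K0(1)]])
      (rule 0)
qed

text \<open>For \<open>s > M\<close> the point \<open>(x, g x - s)\<close> lies below the cylinder
  and hence outside \<open>K\<close>. So \<open>F\<close> lives on the bounded set
  \<open>\<omega> \<times> {0..M}\<close>, where boundedness and continuity suffice. Both slices
  below are of this kind.\<close>

lemma integrable_slice:
  assumes c: "continuous_on (\<omega> \<times> {0<..}) (\<lambda>(x, s). F x s)"
    and b: "\<And>x s. x \<in> \<omega> \<Longrightarrow> norm (F x s) \<le> (B :: real)"
    and z: "\<And>x s. x \<in> \<omega> \<Longrightarrow> (x, g x - s) \<notin> K \<Longrightarrow> F x s = 0"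
  shows "integrable (lborel \<Otimes>\<^sub>M lborel) (\<lambda>(x, s). indicator \<omega> x * indicator {0<..} s * F x s :: real)"
    and "s > 0 \<Longrightarrow> integrable lborel (\<lambda>x. indicator \<omega> x * F x s)"
proof -
  define f where "f z = indicator (\<omega> \<times> {0<..}) z *\<^sub>R (case z of (x, s) \<Rightarrow> F x s)" for z
  have F0: "F x s = 0" if "x \<in> \<omega>" "s > M" for x s
    using z[of x s] K gM[of x] that by (force simp: cylinder_def)
  have B0: "norm (f z) \<le> \<bar>B\<bar>" for z
    unfolding f_def using b[of "fst z" "snd z"] by (cases z) (auto simp: indicator_def)
  have "integrable lborel f"
  proof (rule integrable_bounded_support[where S = "\<omega> \<times> {0..M}"])
    have "open (\<omega> \<times> {0::real<..})" using op by (intro open_Times) auto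
    then show "f \<in> borel_measurable borel"
      unfolding f_def by (intro borel_measurable_continuous_on_indicator c) auto
    show "norm (f z) \<le> \<bar>B\<bar>" for z by (rule B0)
    show "bounded (\<omega> \<times> {0..M})" using bd by (intro bounded_Times) auto
    show "f z = 0" if "z \<notin> \<omega> \<times> {0..M}" for z
      using that F0 by (cases z) (auto simp: f_def indicator_def)
  qed
  then have "integrable (lborel \<Otimes>\<^sub>M lborel) f" by (simp add: lborel_prod)
  moreover have "f = (\<lambda>(x, s). indicator \<omega> x * indicator {0<..} s * F x s)"
    by (auto simp: f_def indicator_def fun_eq_iff)
  ultimately show "integrable (lborel \<Otimes>\<^sub>M lborel) (\<lambda>(x, s). indicator \<omega> x * indicator {0<..} s * F x s)"
    by simp
  assume s: "s > 0"
  have "continuous_on \<omega> (\<lambda>x. F x s)"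
    using continuous_on_compose2[OF c, of \<omega> "\<lambda>x. (x, s)"] s by (force intro!: continuous_intros)
  then show "integrable lborel (\<lambda>x. indicator \<omega> x * F x s)"
    using b by (rule integrable_over_base)
qed

text \<open>On the graph translated down by \<open>s\<close>, the full divergence and its part
  \<open>\<partial>\<^sub>t \<psi> \<bullet> (-\<nabla>g, 1)\<close> have the same integral over \<open>\<omega>\<close>: the difference is the divergence
  of \<open>x \<mapsto> fst (\<psi> (x, g x - s))\<close>. The second one is an exact derivative in \<open>s\<close>.\<close>

definition "div_slice x s = divergence \<psi> (x, g x - s)" for x s
definition "normal_slice x s = snd (D (x, g x - s) (0, 1)) - G x \<bullet> fst (D (x, g x - s) (0, 1))" for x s

lemma div_slice_eq:
  "div_slice x s = (\<Sum>b\<in>Basis. fst (D (x, g x - s) (b, 0)) \<bullet> b) + snd (D (x, g x - s) (0, 1))"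
  unfolding div_slice_def by (rule divergence_prod[OF \<psi>'])

lemma integrable_div_slice:
  "integrable (lborel \<Otimes>\<^sub>M lborel) (\<lambda>(x, s). indicator \<omega> x * indicator {0<..} s * div_slice x s)"
  "s > 0 \<Longrightarrow> integrable lborel (\<lambda>x. indicator \<omega> x * div_slice x s)"
proof -
  obtain B where B: "\<And>v z. norm (D z v) \<le> B v"
    using D_bounded by metis
  have b: "norm (div_slice x s) \<le> (\<Sum>b\<in>Basis. B (b, 0)) + B (0, 1)" for x s
  proof -
    have "\<bar>fst (D z (b, 0)) \<bullet> b\<bar> \<le> B (b, 0)" if "b \<in> Basis" for z b
      using Basis_le_norm[OF that, of "fst (D z (b, 0))"] norm_fst_le[of "fst (D z (b,0))" "snd (D z (b,0))"] B[of z "(b,0)"]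
      by auto
    then have "\<bar>\<Sum>b\<in>Basis. fst (D z (b, 0)) \<bullet> b\<bar> \<le> (\<Sum>b\<in>Basis. B (b, 0))" for z
      by (intro order_trans[OF sum_abs] sum_mono) auto
    moreover have "\<bar>snd (D z (0, 1))\<bar> \<le> B (0, 1)" for z
      using norm_snd_le[of "snd (D z (0,1))" "fst (D z (0,1))"] B[of z "(0, 1)"] by auto
    ultimately show ?thesis unfolding div_slice_eq real_norm_def
      by (intro order_trans[OF abs_triangle_ineq] add_mono) auto
  qed
  have c: "continuous_on (\<omega> \<times> {0<..}) (\<lambda>(x, s). div_slice x s)"
    unfolding div_slice_eq case_prod_beta by (intro continuous_intros cont_shear)
  have z: "div_slice x s = 0" if "(x, g x - s) \<notin> K" for x s
    unfolding div_slice_eq using D_outside[OF that] by simp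
  show "integrable (lborel \<Otimes>\<^sub>M lborel) (\<lambda>(x, s). indicator \<omega> x * indicator {0<..} s * div_slice x s)"
    by (rule integrable_slice(1)[OF c b z])
  show "s > 0 \<Longrightarrow> integrable lborel (\<lambda>x. indicator \<omega> x * div_slice x s)"
    by (rule integrable_slice(2)[OF c b z])
qed

lemma integrable_normal_slice:
  "integrable (lborel \<Otimes>\<^sub>M lborel) (\<lambda>(x, s). indicator \<omega> x * indicator {0<..} s * normal_slice x s)"
  "s > 0 \<Longrightarrow> integrable lborel (\<lambda>x. indicator \<omega> x * normal_slice x s)"
proof -
  obtain B where B: "B \<ge> 0" "\<And>z. norm (D z (0, 1)) \<le> B"
    using D_bounded by metis
  have b: "norm (normal_slice x s) \<le> B + L * B" if "x \<in> \<omega>" for x s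
  proof -
    define d where "d = D (x, g x - s) (0, 1)"
    have "\<bar>snd d\<bar> \<le> B" "norm (fst d) \<le> B"
      using norm_snd_le[of "snd d" "fst d"] norm_fst_le[of "fst d" "snd d"] B(2)[of "(x, g x - s)"]
      unfolding d_def by auto
    moreover have "\<bar>G x \<bullet> fst d\<bar> \<le> L * B"
      using GL[OF that] calculation(2) Cauchy_Schwarz_ineq2[of "G x" "fst d"]
      by (meson mult_mono norm_ge_zero order_trans)
    ultimately show ?thesis unfolding normal_slice_def d_def[symmetric] by simp
  qed
  have c: "continuous_on (\<omega> \<times> {0<..}) (\<lambda>(x, s). normal_slice x s)"
    unfolding normal_slice_def case_prod_beta
    by (intro continuous_intros cont_shear continuous_on_compose2[OF contG]) auto
  have z: "normal_slice x s = 0" if "(x, g x - s) \<notin> K" for x s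
    unfolding normal_slice_def using D_outside[OF that] by simp
  show "integrable (lborel \<Otimes>\<^sub>M lborel) (\<lambda>(x, s). indicator \<omega> x * indicator {0<..} s * normal_slice x s)"
    by (rule integrable_slice(1)[OF c b z])
  show "s > 0 \<Longrightarrow> integrable lborel (\<lambda>x. indicator \<omega> x * normal_slice x s)"
    by (rule integrable_slice(2)[OF c b z])
qed


lemma integral_div_slice:
  assumes "s > 0"
  shows "(LINT x|lborel. indicator \<omega> x * div_slice x s) = (LINT x|lborel. indicator \<omega> x * normal_slice x s)"
proof -
  define h where "h b x = indicator \<omega> x *
    (fst (D (x, g x - s) (b, 0)) \<bullet> b + (G x \<bullet> b) * (fst (D (x, g x - s) (0, 1)) \<bullet> b))" for b x
  \<comment> \<open>The vertical term \<open>snd (D (x, g x - s) (0, 1))\<close> occurs in both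
    slices and cancels; the products with \<open>G x \<bullet> b\<close> add up to the inner product
    in \<open>normal_slice\<close>.\<close>
  have eq: "(\<Sum>b\<in>Basis. h b x) = indicator \<omega> x * div_slice x s - indicator \<omega> x * normal_slice x s" for x
    unfolding h_def div_slice_eq normal_slice_def euclidean_inner[of "G x" "fst (D (x, g x - s) (0, 1))"]
    by (simp add: sum_distrib_left[symmetric] sum.distrib right_diff_distrib distrib_left)
  have "(LINT x|lborel. (\<Sum>b\<in>Basis. h b x)) = (\<Sum>b\<in>Basis. LINT x|lborel. h b x)"
    unfolding h_def by (intro Bochner_Integration.integral_sum horizontal_slice(2))
  also have "\<dots> = 0" unfolding h_def horizontal_slice(1) by simp
  finally show ?thesis
    unfolding eq using integrable_div_slice(2)[OF assms] integrable_normal_slice(2)[OF assms] by simp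
qed

text \<open>Fundamental theorem of calculus in \<open>s\<close>: at \<open>s = 0\<close> the
  primitive \<open>F\<close> is minus the stated value on the graph, and for large \<open>s\<close>
  it vanishes because the point has left the support of \<open>\<psi>\<close>.\<close>

lemma integral_normal_slice:
  assumes x: "x \<in> \<omega>"
  shows "(LINT s|lborel. indicator {0<..} s * normal_slice x s) = snd (\<psi> (x, g x)) - G x \<bullet> fst (\<psi> (x, g x))"
proof -
  \<comment> \<open>Beyond \<open>M\<close>, so that \<open>g x - s\<close> is negative from
    \<open>c\<close> on, and positive, so that \<open>{0..c}\<close> is a genuine interval.\<close>
  define c where "c = max M 0 + 1"
  define F where "F s = G x \<bullet> fst (\<psi> (x, g x - s)) - snd (\<psi> (x, g x - s))" for s
  have out: "(x, g x - s) \<notin> K" if "s \<ge> c" for s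
    using K(2) gM[OF x] that by (auto simp: c_def cylinder_def)
  have F': "(F has_vector_derivative normal_slice x s) (at s within {0..c})" for s
  proof -
    have "((\<lambda>s. (x, g x - s)) has_derivative (\<lambda>h. (0, - h))) (at s)"
      by (auto intro!: derivative_eq_intros)
    from has_derivative_compose[OF this \<psi>']
    have "((\<lambda>s. \<psi> (x, g x - s)) has_derivative (\<lambda>h. D (x, g x - s) (0, - h))) (at s)" .
    then have "(F has_derivative (\<lambda>h. G x \<bullet> fst (D (x, g x - s) (0, - h)) - snd (D (x, g x - s) (0, - h)))) (at s)"
      unfolding F_def
      by (intro has_derivative_diff has_derivative_inner_right has_derivative_fst has_derivative_snd)
    moreover have "D (x, g x - s) (0, - h) = - (h *\<^sub>R D (x, g x - s) (0, 1))" for h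
    proof -
      have "linear (D (x, g x - s))" using \<psi>' has_derivative_linear by blast
      from linear_scale[OF this, of "- h" "(0, 1)"] show ?thesis by simp
    qed
    ultimately have "(F has_vector_derivative normal_slice x s) (at s)"
      unfolding has_vector_derivative_def normal_slice_def by (simp add: algebra_simps)
    then show ?thesis by (rule has_vector_derivative_at_within)
  qed
  have cont: "continuous_on {0..c} (normal_slice x)"
    unfolding normal_slice_def by (intro continuous_intros continuous_on_compose2[OF contD]) auto
  have "(LINT s|lborel. indicator {0<..} s * normal_slice x s)
      = (LINT s|lborel. indicator {0..c} s *\<^sub>R normal_slice x s)"
  proof (rule integral_cong_AE)
    have c: "continuous_on UNIV (normal_slice x)"
      unfolding normal_slice_def by (intro continuous_intros continuous_on_compose2[OF contD]) auto
    show "(\<lambda>s. indicator {0<..} s * normal_slice x s) \<in> borel_measurable lborel"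
      "(\<lambda>s. indicator {0..c} s *\<^sub>R normal_slice x s) \<in> borel_measurable lborel"
      using borel_measurable_continuous_onI[OF c] by auto
    \<comment> \<open>The integrands can differ only at \<open>s = 0\<close>, a null set, since the
      slice vanishes above \<open>c\<close>.\<close>
    show "AE s in lborel. indicator {0<..} s * normal_slice x s = indicator {0..c} s *\<^sub>R normal_slice x s"
      using AE_lborel_singleton[of 0]
    proof eventually_elim
      fix s :: real assume "s \<noteq> 0"
      have "normal_slice x s = 0" if "s > c"
        using D_outside[OF out[of s]] that unfolding normal_slice_def by simp
      then show "indicator {0<..} s * normal_slice x s = indicator {0..c} s *\<^sub>R normal_slice x s"
        using \<open>s \<noteq> 0\<close> by (auto simp: indicator_def)
    qed
  qed
  also have "\<dots> = F c - F 0"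
    by (rule integral_FTC_atLeastAtMost[OF _ F' cont]) (simp add: c_def)
  also have "F c = 0"
    unfolding F_def using zero[OF out[of c]] by simp
  finally show ?thesis unfolding F_def by simp
qed

lemma continuous_divergence: "continuous_on UNIV (divergence \<psi>)"
  unfolding divergence_prod[OF \<psi>'] by (intro continuous_intros contD)

text \<open>The reflection \<open>t = g x - s\<close> preserves Lebesgue measure and maps
  \<open>s > 0\<close> to \<open>t < g x\<close>.\<close>

lemma integral_div_slice_inner:
  "(LINT s|lborel. indicator {0<..} s * div_slice x s)
    = (LINT t|lborel. indicator {..<g x} t * divergence \<psi> (x, t))"
  unfolding div_slice_def
  by (subst lborel_integral_real_affine[where c = "-1" and t = "g x"])
    (auto intro!: Bochner_Integration.integral_cong simp: indicator_def)

text \<open>Measuring depth \<open>s\<close> below the graph straightens the domain. Exchanging the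
  order of integration puts the \<open>x\<close>-integral inside, where for each \<open>s\<close>
  the divergence may be replaced by \<open>normal_slice\<close>; exchanging back, the
  \<open>s\<close>-integral is evaluated exactly and leaves only the values on the graph.\<close>

lemma integral_divergence_subgraph:
  "(LINT z:subgraph \<omega> g|lebesgue. divergence \<psi> z)
    = (LINT x|lborel. indicator \<omega> x * (snd (\<psi> (x, g x)) - G x \<bullet> fst (\<psi> (x, g x))))"
proof -
  define E where "E z = indicator (subgraph \<omega> g) z * divergence \<psi> z" for z
  have mE: "E \<in> borel_measurable borel"
    unfolding E_def using open_subgraph borel_measurable_continuous_onI[OF continuous_divergence] by auto
  have dz: "divergence \<psi> z = 0" if "z \<notin> K" for z
    unfolding divergence_prod[OF \<psi>'] using D_outside[OF that] by simp
  have "\<exists>B\<ge>0. \<forall>z. norm (divergence \<psi> z) \<le> B"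
    by (rule continuous_compact_support_bounded[OF continuous_divergence K(1)]) (rule dz)
  then obtain B where B: "\<And>z. norm (divergence \<psi> z) \<le> B" "B \<ge> 0" by auto
  have bE: "norm (E z) \<le> B" for z
    unfolding E_def using B by (auto simp: indicator_def)
  have zE: "E z = 0" if "z \<notin> K" for z
    unfolding E_def using dz[OF that] by simp
  have "integrable lborel E"
    by (rule integrable_bounded_support[OF mE bE compact_imp_bounded[OF K(1)] zE])
  then have iE: "integrable (lborel \<Otimes>\<^sub>M lborel) E" by (simp add: lborel_prod)
  have Exy: "E (x, t) = indicator \<omega> x * (indicator {..<g x} t * divergence \<psi> (x, t))" for x t
    using dz[of "(x, t)"] K(2) by (cases "0 < t") (auto simp: E_def indicator_def subgraph_def cylinder_def)
  have "(LINT z:subgraph \<omega> g|lebesgue. divergence \<psi> z) = (LINT z|lborel. E z)"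
    unfolding set_lebesgue_integral_def E_def[symmetric] real_scaleR_def
    using mE by (intro integral_completion) simp
  also have "\<dots> = (LINT x|lborel. LINT t|lborel. E (x, t))"
    using lborel_pair.integral_fst'[OF iE] by (simp add: lborel_prod)
  also have "\<dots> = (LINT x|lborel. LINT s|lborel. indicator \<omega> x * indicator {0<..} s * div_slice x s)"
    unfolding Exy mult.assoc integral_mult_right_zero integral_div_slice_inner ..
  also have "\<dots> = (LINT s|lborel. LINT x|lborel. indicator \<omega> x * indicator {0<..} s * div_slice x s)"
    by (rule lborel_pair.Fubini_integral[OF integrable_div_slice(1), symmetric])
  also have "\<dots> = (LINT s|lborel. LINT x|lborel. indicator \<omega> x * indicator {0<..} s * normal_slice x s)"
  proof (rule Bochner_Integration.integral_cong[OF refl])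
    fix s :: real
    show "(LINT x|lborel. indicator \<omega> x * indicator {0<..} s * div_slice x s)
      = (LINT x|lborel. indicator \<omega> x * indicator {0<..} s * normal_slice x s)"
      using integral_div_slice[of s] by (cases "s > 0") auto
  qed
  also have "\<dots> = (LINT x|lborel. LINT s|lborel. indicator \<omega> x * indicator {0<..} s * normal_slice x s)"
    by (rule lborel_pair.Fubini_integral[OF integrable_normal_slice(1)])
  also have "\<dots> = (LINT x|lborel. indicator \<omega> x * (snd (\<psi> (x, g x)) - G x \<bullet> fst (\<psi> (x, g x))))"
  proof (rule Bochner_Integration.integral_cong[OF refl])
    fix x
    show "(LINT s|lborel. indicator \<omega> x * indicator {0<..} s * normal_slice x s)
      = indicator \<omega> x * (snd (\<psi> (x, g x)) - G x \<bullet> fst (\<psi> (x, g x)))"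
      unfolding mult.assoc integral_mult_right_zero
      using integral_normal_slice[of x] by (cases "x \<in> \<omega>") auto
  qed
  finally show ?thesis .
qed

end

end

section \<open>Test fields and C^1 cutoff functions\<close>

lemma Ck_on_1_iff:
  "Ck_on 1 S f \<longleftrightarrow> (\<forall>x\<in>S. f differentiable (at x)) \<and>
     (\<forall>v. continuous_on S (\<lambda>x. frechet_derivative f (at x) v))"
proof -
  have "continuous_on S f" if "\<forall>x\<in>S. f differentiable (at x)"
    using that differentiable_imp_continuous_within continuous_at_imp_continuous_on by blast
  moreover have "length vs \<le> 1 \<longleftrightarrow> vs = [] \<or> (\<exists>v. vs = [v])" for vs :: "'a list"
    by (cases vs) auto
  ultimately show ?thesis unfolding Ck_on_def by auto
qed

text \<open>Together with \<open>test_fieldE\<close> this passes between \<open>test_fields\<close>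
  and the explicit data \<open>K\<close>, \<open>D\<close> on which the divergence formula is
  stated.\<close>

lemma test_fieldI:
  assumes K: "compact K" "K \<subseteq> C"
    and D: "\<And>z. (\<psi> has_derivative D z) (at z)"
    and cont: "\<And>v. continuous_on UNIV (\<lambda>z. D z v)"
    and zero: "\<And>z. z \<notin> K \<Longrightarrow> \<psi> z = 0"
    and le: "\<And>z. norm (\<psi> z) \<le> 1"
  shows "\<psi> \<in> test_fields C"
proof -
  have "{z. \<psi> z \<noteq> 0} \<subseteq> K" using zero by auto
  then have s: "closure {z. \<psi> z \<noteq> 0} \<subseteq> K"
    using K(1) by (intro closure_minimal compact_imp_closed)
  then have "compact (closure {z. \<psi> z \<noteq> 0})"
    using compact_Int_closed[OF K(1) closed_closure, of "{z. \<psi> z \<noteq> 0}"] by (simp add: inf.absorb2)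
  moreover have "Ck_on 1 UNIV \<psi>"
    unfolding Ck_on_1_iff frechet_derivative_at[OF D, symmetric]
    using D cont by (auto simp: differentiable_def)
  ultimately show ?thesis
    unfolding test_fields_def using s K(2) le by auto
qed

lemma test_fieldE:
  assumes "\<psi> \<in> test_fields C"
  obtains K D where "compact K" "K \<subseteq> C" "\<And>z. (\<psi> has_derivative D z) (at z)"
    "\<And>v. continuous_on UNIV (\<lambda>z. D z v)" "\<And>z. z \<notin> K \<Longrightarrow> \<psi> z = 0" "\<And>z. norm (\<psi> z) \<le> 1"
proof (rule that[of "closure {z. \<psi> z \<noteq> 0}" "\<lambda>z. frechet_derivative \<psi> (at z)"])
  show "\<psi> z = 0" if "z \<notin> closure {z. \<psi> z \<noteq> 0}" for z
    using that closure_subset[of "{z. \<psi> z \<noteq> 0}"] by auto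
qed (use assms in \<open>simp_all only: test_fields_def Ck_on_1_iff frechet_derivative_works, auto\<close>)

text \<open>Squaring removes the corner of the positive part at 0 and leaves a continuous
  derivative. This function builds the bumps of the cutoffs below and later flattens the graph near
  its top.\<close>

lemma DERIV_pos_part_square:
  "((\<lambda>s::real. (max 0 s)\<^sup>2) has_real_derivative 2 * max 0 s) (at s)"
proof (cases s "0::real" rule: linorder_cases)
  case less
  have "((\<lambda>s::real. 0) has_real_derivative 2 * max 0 s) (at s)" using less by simp
  then show ?thesis
    by (rule has_field_derivative_transform_within_open[where S = "{..<0}"]) (use less in auto)
next
  case greater
  have "((\<lambda>s::real. s\<^sup>2) has_real_derivative 2 * max 0 s) (at s)"
    using greater by (auto intro!: derivative_eq_intros)
  then show ?thesis
    by (rule has_field_derivative_transform_within_open[where S = "{0<..}"]) (use greater in auto)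
next
  case equal
  have "(\<lambda>h::real. (max 0 h)\<^sup>2 / h) \<midarrow>0\<rightarrow> 0"
  proof (rule Lim_null_comparison)
    show "eventually (\<lambda>h::real. norm ((max 0 h)\<^sup>2 / h) \<le> \<bar>h\<bar>) (at 0)"
      by (intro always_eventually) (auto simp: max_def power2_eq_square)
    show "((\<lambda>h::real. \<bar>h\<bar>) \<longlongrightarrow> 0) (at 0)" by (auto intro!: tendsto_eq_intros)
  qed
  then show ?thesis using equal by (simp add: DERIV_def)
qed

text \<open>By the Lindelof property \<open>U\<close> is a countable union of open balls whose
  closed balls lie in \<open>U\<close>. The sum of the first \<open>n\<close> bumps has compact
  support in \<open>U\<close>, and each point of \<open>U\<close> is eventually in the positivity
  set; rescaling by \<open>n\<close> before squashing into the unit interval forces the limit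
  1.\<close>

lemma cutoff_sequence:
  fixes U :: "'b::euclidean_space set"
  assumes "open U"
  obtains \<eta> :: "nat \<Rightarrow> 'b \<Rightarrow> real" and \<eta>' K where
    "\<And>n. compact (K n)" "\<And>n. K n \<subseteq> U"
    "\<And>n x. (\<eta> n has_derivative \<eta>' n x) (at x)"
    "\<And>n v. continuous_on UNIV (\<lambda>x. \<eta>' n x v)"
    "\<And>n x. x \<notin> K n \<Longrightarrow> \<eta> n x = 0"
    "\<And>n x. 0 \<le> \<eta> n x" "\<And>n x. \<eta> n x \<le> 1"
    "\<And>x. x \<in> U \<Longrightarrow> (\<lambda>n. \<eta> n x) \<longlonglongrightarrow> 1"
proof (cases "U = {}")
  case True
  show thesis
    by (rule that[of "\<lambda>n. {}" "\<lambda>n x. 0" "\<lambda>n x v. 0"]) (use True in auto)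
next
  case False
  define F where "F = {ball c r | c r. 0 < r \<and> cball c r \<subseteq> U}"
  have FU: "\<Union>F = U"
  proof (rule antisym)
    show "\<Union>F \<subseteq> U" unfolding F_def using ball_subset_cball by blast
    show "U \<subseteq> \<Union>F"
    proof
      fix x assume "x \<in> U"
      then obtain r where "0 < r" "cball x r \<subseteq> U"
        using assms open_contains_cball by blast
      then show "x \<in> \<Union>F" unfolding F_def by (auto intro!: exI[of _ "ball x r"])
    qed
  qed
  have oF: "open S" if "S \<in> F" for S using that unfolding F_def by auto
  obtain F' where F': "F' \<subseteq> F" "countable F'" "\<Union>F' = \<Union>F"
    by (rule Lindelof[OF oF])
  note F' = F'(1,2) F'(3)[unfolded FU]
  have ne: "F' \<noteq> {}" using F'(3) False by auto
  define B where "B = from_nat_into F'"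
  have BF: "B i \<in> F'" for i unfolding B_def using ne by (rule from_nat_into)
  have "\<forall>i. \<exists>c r. B i = ball c r \<and> 0 < r \<and> cball c r \<subseteq> U"
    using BF F'(1) unfolding F_def by blast
  then obtain c r where cr: "\<And>i. B i = ball (c i) (r i)" "\<And>i. 0 < r i" "\<And>i. cball (c i) (r i) \<subseteq> U"
    by metis
  \<comment> \<open>A quadratic polynomial that is positive exactly on the ball \<open>B i\<close>;
    the square of its positive part is the C^1 bump of that ball.\<close>
  define q where "q i x = (r i)\<^sup>2 - (x - c i) \<bullet> (x - c i)" for i x
  define S where "S n x = (\<Sum>i<n. (max 0 (q i x))\<^sup>2)" for n x
  define S' where "S' n x v = (\<Sum>i<n. (2 * max 0 (q i x)) * (- 2 * ((x - c i) \<bullet> v)))" for n x v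
  \<comment> \<open>composing a growing sum of bumps with \<open>s \<mapsto> s / (1 + s)\<close> avoids smooth partitions of unity\<close>
  define \<eta> where "\<eta> n x = real n * S n x / (1 + real n * S n x)" for n x
  define \<eta>' where "\<eta>' n x v = real n * S' n x v / (1 + real n * S n x)\<^sup>2" for n x v
  define K where "K n = (\<Union>i<n. cball (c i) (r i))" for n
  have S0: "0 \<le> S n x" for n x unfolding S_def by (intro sum_nonneg) auto
  have pos: "0 < 1 + real n * S n x" for n x using S0[of n x] by (simp add: add_pos_nonneg)
  have qx: "0 < q i x \<longleftrightarrow> x \<in> B i" for i x
  proof -
    have "x \<in> B i \<longleftrightarrow> norm (x - c i) < r i" by (simp add: cr(1) dist_norm norm_minus_commute)
    also have "\<dots> \<longleftrightarrow> (norm (x - c i))\<^sup>2 < (r i)\<^sup>2"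
      using cr(2)[of i] by (metis less_eq_real_def norm_ge_zero power2_less_imp_less power_strict_mono zero_less_numeral)
    finally show ?thesis unfolding q_def by (simp add: power2_norm_eq_inner)
  qed
  have S': "(S n has_derivative S' n x) (at x)" for n x
    unfolding S_def S'_def
  proof (intro has_derivative_sum)
    fix i
    have "(q i has_derivative (\<lambda>v. - 2 * ((x - c i) \<bullet> v))) (at x)"
      unfolding q_def by (auto intro!: derivative_eq_intros simp: inner_commute)
    from has_derivative_compose[OF this DERIV_pos_part_square[of "q i x", unfolded has_field_derivative_def]]
    show "((\<lambda>x. (max 0 (q i x))\<^sup>2) has_derivative (\<lambda>v. 2 * max 0 (q i x) * (- 2 * ((x - c i) \<bullet> v)))) (at x)" .
  qed
  have cS: "continuous_on UNIV (S n)" for n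
    by (intro continuous_at_imp_continuous_on ballI has_derivative_continuous[OF S'])
  have cS': "continuous_on UNIV (\<lambda>x. S' n x v)" for n v
    unfolding S'_def q_def by (intro continuous_intros)
  show thesis
  proof (rule that[of K \<eta> \<eta>'])
    show "compact (K n)" for n unfolding K_def by auto
    show "K n \<subseteq> U" for n unfolding K_def using cr(3) by auto
    show "(\<eta> n has_derivative \<eta>' n x) (at x)" for n x
    proof -
      have "((\<lambda>s. real n * s / (1 + real n * s)) has_real_derivative real n / (1 + real n * S n x)\<^sup>2) (at (S n x))"
        using pos[of n x] by (auto intro!: derivative_eq_intros simp: field_simps power2_eq_square)
      from has_derivative_compose[OF S' this[unfolded has_field_derivative_def]]
      show ?thesis unfolding \<eta>_def \<eta>'_def by simp
    qed
    show "continuous_on UNIV (\<lambda>x. \<eta>' n x v)" for n v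
      unfolding \<eta>'_def using pos by (intro continuous_intros cS cS') (metis less_irrefl zero_eq_power2)
    show "\<eta> n x = 0" if "x \<notin> K n" for n x
    proof -
      have "q i x \<le> 0" if "i < n" for i
        using qx[of i x] \<open>x \<notin> K n\<close> that ball_subset_cball[of "c i" "r i"] unfolding K_def cr(1) by force
      then have "S n x = 0" unfolding S_def by simp
      then show ?thesis unfolding \<eta>_def by simp
    qed
    show "0 \<le> \<eta> n x" for n x
      unfolding \<eta>_def using S0[of n x] by simp
    show "\<eta> n x \<le> 1" for n x
      unfolding \<eta>_def using pos[of n x] by simp
    show "(\<lambda>n. \<eta> n x) \<longlonglongrightarrow> 1" if "x \<in> U" for x
    proof -
      obtain Y where Y: "Y \<in> F'" "x \<in> Y" using \<open>x \<in> U\<close> F'(3) by auto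
      obtain i where "B i = Y" unfolding B_def using from_nat_into_surj[OF F'(2) Y(1)] by auto
      then have i: "x \<in> B i" using Y(2) by simp
      define \<beta> where "\<beta> = (max 0 (q i x))\<^sup>2"
      have \<beta>: "\<beta> > 0" using qx[of i x] i unfolding \<beta>_def by simp
      have "(\<lambda>n. real n * \<beta> / (1 + real n * \<beta>)) \<longlonglongrightarrow> 1"
      proof -
        have "filterlim (\<lambda>n. 1 + real n * \<beta>) at_top sequentially"
          by (intro filterlim_tendsto_add_at_top[OF tendsto_const]
              filterlim_at_top_mult_tendsto_pos[OF tendsto_const \<beta>] filterlim_real_sequentially)
        then have "(\<lambda>n. 1 - inverse (1 + real n * \<beta>)) \<longlonglongrightarrow> 1 - 0"
          by (intro tendsto_diff tendsto_const tendsto_inverse_0_at_top)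
        moreover have "1 - inverse (1 + real n * \<beta>) = real n * \<beta> / (1 + real n * \<beta>)" for n
        proof -
          have "1 + real n * \<beta> > 0" using \<beta> by (simp add: add_pos_nonneg)
          then show ?thesis by (simp add: field_simps)
        qed
        ultimately show ?thesis by simp
      qed
      \<comment> \<open>Once \<open>n > i\<close> the sum contains the bump \<open>\<beta>\<close>
        of a ball around \<open>x\<close>, and the squashing map is increasing.\<close>
      moreover have "eventually (\<lambda>n. real n * \<beta> / (1 + real n * \<beta>) \<le> \<eta> n x) sequentially"
        using eventually_gt_at_top[of i]
      proof eventually_elim
        fix n assume "i < n"
        then have "\<beta> \<le> S n x" unfolding S_def \<beta>_def by (intro member_le_sum) auto
        then have "real n * \<beta> \<le> real n * S n x" by (intro mult_left_mono) auto
        then show "real n * \<beta> / (1 + real n * \<beta>) \<le> \<eta> n x"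
          unfolding \<eta>_def using \<beta> pos[of n x] by (simp add: field_simps add_pos_nonneg)
      qed
      moreover have "eventually (\<lambda>n. \<eta> n x \<le> 1) sequentially"
        unfolding \<eta>_def using pos[of _ x] by simp
      ultimately show ?thesis
        by (rule tendsto_sandwich[OF _ _ _ tendsto_const, rotated 2])
    qed
  qed
qed

section \<open>Relative perimeter and volume of a subgraph\<close>

context bounded_C1_graph
begin

lemma area_factor_bound: "x \<in> \<omega> \<Longrightarrow> sqrt (1 + (norm (G x))\<^sup>2) \<le> sqrt (1 + L\<^sup>2)"
  using GL[of x] by (intro real_sqrt_le_mono add_left_mono power_mono) auto

lemma integrable_area_factor: "integrable lborel (\<lambda>x. indicator \<omega> x * sqrt (1 + (norm (G x))\<^sup>2))"
  by (rule integrable_over_base[where B = "sqrt (1 + L\<^sup>2)"])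
    (use area_factor_bound in \<open>auto intro!: continuous_intros contG\<close>)

text \<open>The set where \<open>f\<close> is positive is open and nonempty, hence not null; a zero
  integral of a nonnegative function would make it null.\<close>

lemma integral_over_base_pos:
  fixes f :: "'a \<Rightarrow> real"
  assumes c: "continuous_on \<omega> f" and i: "integrable lborel (\<lambda>x. indicator \<omega> x * f x)"
    and nonneg: "\<And>x. x \<in> \<omega> \<Longrightarrow> 0 \<le> f x" and y: "y \<in> \<omega>" "0 < f y"
  shows "0 < (LINT x|lborel. indicator \<omega> x * f x)"
proof -
  let ?S = "\<omega> \<inter> f -` {0<..}"
  have 0: "0 \<le> indicator \<omega> x * f x" for x using nonneg by (auto simp: indicator_def)
  have "open ?S" by (intro continuous_open_preimage c op) auto
  then have nn: "\<not> negligible ?S" using y by (intro open_not_negligible) auto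
  have "(LINT x|lborel. indicator \<omega> x * f x) \<noteq> 0"
  proof
    assume "(LINT x|lborel. indicator \<omega> x * f x) = 0"
    then have "AE x in lborel. indicator \<omega> x * f x = 0"
      using integral_nonneg_eq_0_iff_AE[OF i] 0 by auto
    then have "AE x in lborel. x \<notin> ?S" by eventually_elim auto
    then have "?S \<in> null_sets lborel"
      using \<open>open ?S\<close> by (subst AE_iff_null_sets) auto
    then show False using nn by (simp add: negligible_iff_null_sets null_sets_completionI)
  qed
  moreover have "0 \<le> (LINT x|lborel. indicator \<omega> x * f x)" using 0 by (intro Bochner_Integration.integral_nonneg) auto
  ultimately show ?thesis by linarith
qed

text \<open>After the divergence formula the integrand is the inner product of \<open>\<psi>\<close>
  with \<open>(- G x, 1)\<close>, and Cauchy-Schwarz with \<open>norm \<psi> \<le> 1\<close> bounds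
  it by the area factor.\<close>

lemma rel_perimeter_subgraph_le:
  "rel_perimeter (cylinder \<omega>) (subgraph \<omega> g)
    \<le> ereal (LINT x|lborel. indicator \<omega> x * sqrt (1 + (norm (G x))\<^sup>2))"
  unfolding rel_perimeter_def
proof (rule SUP_least)
  fix \<psi> :: "'a \<times> real \<Rightarrow> 'a \<times> real" assume "\<psi> \<in> test_fields (cylinder \<omega>)"
  then obtain K D where K: "compact K" "K \<subseteq> cylinder \<omega>"
    and D: "\<And>z. (\<psi> has_derivative D z) (at z)" and cD: "\<And>v. continuous_on UNIV (\<lambda>z. D z v)"
    and zero: "\<And>z. z \<notin> K \<Longrightarrow> \<psi> z = 0" and le: "\<And>z. norm (\<psi> z) \<le> 1"
    by (rule test_fieldE) blast
  have c\<psi>: "continuous_on UNIV \<psi>"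
    by (intro continuous_at_imp_continuous_on ballI has_derivative_continuous[OF D])
  define f where "f x = snd (\<psi> (x, g x)) - G x \<bullet> fst (\<psi> (x, g x))" for x
  have cf: "continuous_on \<omega> f"
    unfolding f_def by (intro continuous_intros continuous_on_compose2[OF c\<psi>] cont_g contG) auto
  have fle: "\<bar>f x\<bar> \<le> sqrt (1 + (norm (G x))\<^sup>2)" for x
  proof -
    have "f x = (- G x, 1) \<bullet> \<psi> (x, g x)"
      unfolding f_def by (cases "\<psi> (x, g x)") simp
    then have "\<bar>f x\<bar> \<le> norm (- G x, 1::real) * norm (\<psi> (x, g x))"
      using Cauchy_Schwarz_ineq2 by metis
    also have "\<dots> \<le> norm (- G x, 1::real) * 1"
      using le by (intro mult_left_mono) auto
    finally show ?thesis by (simp add: norm_Pair add.commute)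
  qed
  have "(LINT z:subgraph \<omega> g|lebesgue. divergence \<psi> z) = (LINT x|lborel. indicator \<omega> x * f x)"
    unfolding f_def by (rule integral_divergence_subgraph[OF K D cD zero])
  also have "\<dots> \<le> (LINT x|lborel. indicator \<omega> x * sqrt (1 + (norm (G x))\<^sup>2))"
  proof (rule integral_mono[OF integrable_over_base[OF cf] integrable_area_factor])
    show "norm (f x) \<le> sqrt (1 + L\<^sup>2)" if "x \<in> \<omega>" for x
      using order_trans[OF fle area_factor_bound[OF that]] by simp
    show "indicator \<omega> x * f x \<le> indicator \<omega> x * sqrt (1 + (norm (G x))\<^sup>2)" for x
      using fle[of x] by (intro mult_left_mono) auto
  qed
  finally show "ereal (LINT z:subgraph \<omega> g|lebesgue. divergence \<psi> z)
    \<le> ereal (LINT x|lborel. indicator \<omega> x * sqrt (1 + (norm (G x))\<^sup>2))" by simp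
qed

text \<open>Cauchy-Schwarz is an equality for the unit normal of the graph. That field is C^1
  because \<open>G\<close> is, and the cutoffs make it admissible; since \<open>g\<close> is
  positive, the graph lies in the cylinder, where the cutoffs tend to 1.\<close>

lemma rel_perimeter_subgraph_ge:
  assumes pos: "\<And>x. x \<in> \<omega> \<Longrightarrow> 0 < g x"
    and G': "\<And>x. x \<in> \<omega> \<Longrightarrow> (G has_derivative G' x) (at x)"
    and contG': "\<And>v. continuous_on \<omega> (\<lambda>x. G' x v)"
  shows "ereal (LINT x|lborel. indicator \<omega> x * sqrt (1 + (norm (G x))\<^sup>2))
    \<le> rel_perimeter (cylinder \<omega>) (subgraph \<omega> g)"
proof -
  have opC: "open (cylinder \<omega>)" unfolding cylinder_def using op by (intro open_Times) auto
  obtain \<eta> :: "nat \<Rightarrow> 'a \<times> real \<Rightarrow> real" and \<eta>' K where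
    K: "\<And>n. compact (K n)" "\<And>n. K n \<subseteq> cylinder \<omega>"
    and \<eta>': "\<And>n x. (\<eta> n has_derivative \<eta>' n x) (at x)"
    and c\<eta>': "\<And>n v. continuous_on UNIV (\<lambda>x. \<eta>' n x v)"
    and \<eta>0: "\<And>n x. x \<notin> K n \<Longrightarrow> \<eta> n x = 0"
    and \<eta>: "\<And>n x. 0 \<le> \<eta> n x" "\<And>n x. \<eta> n x \<le> 1"
    and lim: "\<And>x. x \<in> cylinder \<omega> \<Longrightarrow> (\<lambda>n. \<eta> n x) \<longlonglongrightarrow> 1"
    by (rule cutoff_sequence[OF opC], rule that; assumption)
  have c\<eta>: "continuous_on UNIV (\<eta> n)" for n
    by (intro continuous_at_imp_continuous_on ballI has_derivative_continuous[OF \<eta>'])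
  define W where "W x = sqrt (1 + (norm (G x))\<^sup>2)" for x
  define r where "r x = inverse (sqrt (1 + G x \<bullet> G x))" for x
  define r' where "r' x v = - (G x \<bullet> G' x v) * (r x * r x * r x)" for x v
  have rW: "r x = inverse (W x)" for x unfolding r_def W_def power2_norm_eq_inner ..
  have p: "0 < 1 + G x \<bullet> G x" for x by (simp add: add_pos_nonneg)
  have r': "(r has_derivative r' x) (at x)" if "x \<in> \<omega>" for x
  proof -
    have 1: "((\<lambda>x. 1 + G x \<bullet> G x) has_derivative (\<lambda>v. 2 * (G x \<bullet> G' x v))) (at x)"
      by (auto intro!: derivative_eq_intros G' that simp: inner_commute)
    have 2: "((\<lambda>s. inverse (sqrt s)) has_real_derivative - (r x * r x * r x) / 2) (at (1 + G x \<bullet> G x))"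
      using p[of x] unfolding r_def
      by (auto intro!: derivative_eq_intros simp: field_simps power2_eq_square)
    have "r' x = (\<lambda>v. - (r x * r x * r x) / 2 * (2 * (G x \<bullet> G' x v)))"
      unfolding r'_def by (simp add: fun_eq_iff)
    then show ?thesis
      using has_derivative_compose[OF 1 2[unfolded has_field_derivative_def]] unfolding r_def by simp
  qed
  have cr: "continuous_on \<omega> r"
    by (intro continuous_at_imp_continuous_on ballI has_derivative_continuous[OF r'])
  \<comment> \<open>The upward unit normal of the graph, used as a field that does not depend on the
    height.\<close>
  define V where "V x = r x *\<^sub>R (- G x, 1::real)" for x
  define V' where "V' x v = r x *\<^sub>R (- G' x v, 0::real) + r' x v *\<^sub>R (- G x, 1)" for x v
  have V': "(V has_derivative V' x) (at x)" if "x \<in> \<omega>" for x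
    unfolding V_def V'_def
    by (intro has_derivative_scaleR r' has_derivative_Pair has_derivative_minus G' that has_derivative_const)
  have cV: "continuous_on \<omega> V" unfolding V_def by (intro continuous_intros cr contG)
  have cV': "continuous_on \<omega> (\<lambda>x. V' x v)" for v
    unfolding V'_def r'_def by (intro continuous_intros cr contG contG')
  have W1: "1 \<le> W x" for x unfolding W_def by simp
  have nV: "norm (V x) = 1" for x
  proof -
    have "norm (- G x, 1::real) = W x" by (simp add: norm_Pair W_def add.commute)
    then show ?thesis unfolding V_def rW norm_scaleR using W1[of x] by simp
  qed
  have VW: "snd (V x) - G x \<bullet> fst (V x) = W x" for x
  proof -
    have "snd (V x) - G x \<bullet> fst (V x) = r x * (W x * W x)"
      using p[of x] by (simp add: V_def W_def power2_norm_eq_inner algebra_simps)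
    then show ?thesis unfolding rW using W1[of x] by simp
  qed
  define \<psi> where "\<psi> n z = \<eta> n z *\<^sub>R V (fst z)" for n z
  define D where "D n z v = \<eta> n z *\<^sub>R V' (fst z) (fst v) + \<eta>' n z v *\<^sub>R V (fst z)" for n z v
  have fstC: "fst z \<in> \<omega>" if "z \<in> cylinder \<omega>" for z using that by (auto simp: cylinder_def)
  have \<psi>': "(\<psi> n has_derivative D n z) (at z)" if "z \<in> cylinder \<omega>" for n z
  proof -
    have "((\<lambda>z. V (fst z)) has_derivative (\<lambda>v. V' (fst z) (fst v))) (at z)"
      using has_derivative_compose[of fst fst z UNIV V "V' (fst z)", OF _ V'[OF fstC[OF that]]]
        has_derivative_fst[OF has_derivative_ident] by blast
    then show ?thesis unfolding \<psi>_def D_def by (intro has_derivative_scaleR \<eta>')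
  qed
  have cD: "continuous_on (cylinder \<omega>) (\<lambda>z. D n z v)" for n v
    unfolding D_def
    by (intro continuous_intros continuous_on_compose2[OF cV] continuous_on_compose2[OF cV']
        continuous_on_subset[OF c\<eta>] continuous_on_subset[OF c\<eta>']) (auto simp: cylinder_def)
  have \<psi>0: "\<psi> n z = 0" if "z \<notin> K n" for n z unfolding \<psi>_def using \<eta>0[OF that] by simp
  \<comment> \<open>Differentiability of \<open>V\<close> is known only over
    \<open>\<omega>\<close>, so the derivative is set to zero off the cylinder; the support of the
    cutoff makes this the true derivative.\<close>
  define D0 where "D0 n z = (if z \<in> cylinder \<omega> then D n z else (\<lambda>v. 0))" for n z
  have D0: "(\<psi> n has_derivative D0 n z) (at z)" for n z
    unfolding D0_def by (rule zero_extension_C1(1)[OF opC K \<psi>' cD \<psi>0])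
  have cD0: "continuous_on UNIV (\<lambda>z. D0 n z v)" for n v
    unfolding D0_def by (rule zero_extension_C1(2)[OF opC K \<psi>' cD \<psi>0])
  have le: "norm (\<psi> n z) \<le> 1" for n z unfolding \<psi>_def using \<eta>[of n z] by (simp add: nV)
  have test: "\<psi> n \<in> test_fields (cylinder \<omega>)" for n
    by (rule test_fieldI[OF K D0 cD0 \<psi>0 le])
  define I where "I n = (LINT x|lborel. indicator \<omega> x * (\<eta> n (x, g x) * W x))" for n
  have I: "ereal (I n) \<le> rel_perimeter (cylinder \<omega>) (subgraph \<omega> g)" for n
  proof -
    have "(LINT z:subgraph \<omega> g|lebesgue. divergence (\<psi> n) z)
      = (LINT x|lborel. indicator \<omega> x * (snd (\<psi> n (x, g x)) - G x \<bullet> fst (\<psi> n (x, g x))))"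
      by (rule integral_divergence_subgraph[OF K D0 cD0 \<psi>0])
    also have "\<dots> = I n"
      unfolding I_def VW[symmetric] \<psi>_def by (simp add: right_diff_distrib)
    finally show ?thesis
      unfolding rel_perimeter_def by (metis SUP_upper test)
  qed
  have cW: "continuous_on \<omega> W" unfolding W_def by (intro continuous_intros contG)
  \<comment> \<open>Dominated convergence, with the area factor \<open>W\<close> as majorant since
    the cutoffs take values between 0 and 1.\<close>
  have "I \<longlonglongrightarrow> (LINT x|lborel. indicator \<omega> x * W x)"
    unfolding I_def
  proof (rule integral_dominated_convergence[where w = "\<lambda>x. indicator \<omega> x * W x"])
    show "integrable lborel (\<lambda>x. indicator \<omega> x * W x)"
      using integrable_area_factor unfolding W_def .
    then show "(\<lambda>x. indicator \<omega> x * W x) \<in> borel_measurable lborel" by auto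
    show "(\<lambda>x. indicator \<omega> x * (\<eta> n (x, g x) * W x)) \<in> borel_measurable lborel" for n
    proof -
      have "continuous_on \<omega> (\<lambda>x. \<eta> n (x, g x) * W x)"
        by (intro continuous_intros continuous_on_compose2[OF c\<eta>] cont_g cW) auto
      from borel_measurable_continuous_on_indicator[OF _ this] op show ?thesis by auto
    qed
    show "AE x in lborel. (\<lambda>n. indicator \<omega> x * (\<eta> n (x, g x) * W x)) \<longlonglongrightarrow> indicator \<omega> x * W x"
    proof (rule AE_I2)
      fix x
      show "(\<lambda>n. indicator \<omega> x * (\<eta> n (x, g x) * W x)) \<longlonglongrightarrow> indicator \<omega> x * W x"
      proof (cases "x \<in> \<omega>")
        case True
        then have "(\<lambda>n. \<eta> n (x, g x)) \<longlonglongrightarrow> 1" using pos by (intro lim) (auto simp: cylinder_def)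
        then have "(\<lambda>n. \<eta> n (x, g x) * W x) \<longlonglongrightarrow> 1 * W x" by (intro tendsto_mult tendsto_const)
        then show ?thesis using True by simp
      qed simp
    qed
    show "AE x in lborel. norm (indicator \<omega> x * (\<eta> n (x, g x) * W x)) \<le> indicator \<omega> x * W x" for n
    proof (rule AE_I2)
      fix x
      show "norm (indicator \<omega> x * (\<eta> n (x, g x) * W x)) \<le> indicator \<omega> x * W x"
        using \<eta>[of n "(x, g x)"] W1[of x] by (auto simp: indicator_def abs_mult mult_le_cancel_right1)
    qed
  qed
  then have "(\<lambda>n. ereal (I n)) \<longlonglongrightarrow> ereal (LINT x|lborel. indicator \<omega> x * W x)" by simp
  then have "ereal (LINT x|lborel. indicator \<omega> x * W x) \<le> rel_perimeter (cylinder \<omega>) (subgraph \<omega> g)"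
    using I by (intro LIMSEQ_le_const2[of "\<lambda>n. ereal (I n)"]) auto
  then show ?thesis unfolding W_def .
qed

lemma emeasure_subgraph:
  assumes pos: "\<And>x. x \<in> \<omega> \<Longrightarrow> 0 \<le> g x"
  shows "emeasure lebesgue (subgraph \<omega> g) = ennreal (LINT x|lborel. indicator \<omega> x * g x)"
    and "integrable lborel (\<lambda>x. indicator \<omega> x * g x)"
proof -
  show i: "integrable lborel (\<lambda>x. indicator \<omega> x * g x)"
    by (rule integrable_over_base[OF cont_g, of M]) (use pos gM in auto)
  have m: "subgraph \<omega> g \<in> sets borel" using open_subgraph by auto
  then have "emeasure lebesgue (subgraph \<omega> g) = emeasure (lborel \<Otimes>\<^sub>M lborel) (subgraph \<omega> g)"
    by (simp add: lborel_prod)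
  also have "\<dots> = (\<integral>\<^sup>+x. emeasure lborel (Pair x -` subgraph \<omega> g) \<partial>lborel)"
  proof (rule lborel.emeasure_pair_measure_alt)
    show "subgraph \<omega> g \<in> sets (lborel \<Otimes>\<^sub>M lborel)" unfolding lborel_prod using m by simp
  qed
  also have "\<dots> = (\<integral>\<^sup>+x. ennreal (indicator \<omega> x * g x) \<partial>lborel)"
  proof (rule nn_integral_cong)
    fix x :: 'a
    have "Pair x -` subgraph \<omega> g = (if x \<in> \<omega> then {0<..<g x} else {})"
      by (auto simp: subgraph_def)
    then show "emeasure lborel (Pair x -` subgraph \<omega> g) = ennreal (indicator \<omega> x * g x)"
      using pos[of x] by auto
  qed
  also have "\<dots> = ennreal (LINT x|lborel. indicator \<omega> x * g x)"
    using pos by (intro nn_integral_eq_integral i) (auto simp: indicator_def)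
  finally show "emeasure lebesgue (subgraph \<omega> g) = ennreal (LINT x|lborel. indicator \<omega> x * g x)" .
qed

end

section \<open>Convexity of the area integrand and calculus of C^2 functions\<close>

text \<open>The slope \<open>(1 - l) * p\<close> is a convex combination of \<open>p\<close> and 0,
  so the area integrand is at most \<open>(1 - l) * W + l\<close>, where \<open>W\<close> is its
  value at \<open>p\<close>. The difference of the squares is
  \<open>2 * l * (1 - l) * (W - 1)\<close>, and \<open>c \<le> W\<close> turns the gain
  \<open>l * (W - 1)\<close> into at least \<open>l * (c - 1)\<close>.\<close>

lemma sqrt_area_factor_convex:
  fixes p l c :: real
  assumes l: "0 \<le> l" "l \<le> 1" and c: "c \<le> sqrt (1 + p\<^sup>2)"
  shows "sqrt (1 + ((1 - l) * p)\<^sup>2) \<le> sqrt (1 + p\<^sup>2) - l * (c - 1)"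
proof -
  define W where "W = sqrt (1 + p\<^sup>2)"
  have W: "W\<^sup>2 = 1 + p\<^sup>2" "1 \<le> W" unfolding W_def by auto
  have "((1 - l) * W + l)\<^sup>2 - (1 + ((1 - l) * p)\<^sup>2) = (1 - l)\<^sup>2 * (W\<^sup>2 - p\<^sup>2) + 2 * l * (1 - l) * W + l\<^sup>2 - 1"
    by (simp add: power2_eq_square algebra_simps)
  also have "\<dots> = 2 * l * (1 - l) * (W - 1)"
    unfolding W(1) by (simp add: power2_eq_square algebra_simps)
  also have "\<dots> \<ge> 0" using l W(2) by simp
  finally have "1 + ((1 - l) * p)\<^sup>2 \<le> ((1 - l) * W + l)\<^sup>2" by simp
  then have "sqrt (1 + ((1 - l) * p)\<^sup>2) \<le> (1 - l) * W + l"
    using l W(2) by (intro real_le_lsqrt) auto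
  also have "\<dots> = W - l * (W - 1)" by (simp add: algebra_simps)
  also have "\<dots> \<le> W - l * (c - 1)"
    using mult_left_mono[OF c l(1)] unfolding W_def[symmetric] by (simp add: algebra_simps)
  finally show ?thesis unfolding W_def .
qed

lemma frechet_derivative_eq_grad:
  assumes "f differentiable (at x)"
  shows "frechet_derivative f (at x) v = grad f x \<bullet> v"
proof -
  have l: "linear (frechet_derivative f (at x))"
    using assms by (rule linear_frechet_derivative)
  have "frechet_derivative f (at x) v = frechet_derivative f (at x) (\<Sum>b\<in>Basis. (v \<bullet> b) *\<^sub>R b)"
    by (simp add: euclidean_representation)
  also have "\<dots> = (\<Sum>b\<in>Basis. (v \<bullet> b) * frechet_derivative f (at x) b)"
    by (simp add: linear_sum[OF l] linear_scale[OF l])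
  finally show ?thesis
    unfolding grad_def by (simp add: inner_sum_left inner_commute[of v] mult.commute)
qed

text \<open>Restates the iterated directional derivatives as a gradient field with its own
  continuous derivative, the form needed for the graph locale and the lower perimeter bound.\<close>

lemma Ck_on_2_imp:
  fixes f :: "'a::euclidean_space \<Rightarrow> real"
  assumes "Ck_on 2 S f"
  shows "x \<in> S \<Longrightarrow> (f has_derivative (\<lambda>v. grad f x \<bullet> v)) (at x)"
    and "x \<in> S \<Longrightarrow> (grad f has_derivative
      (\<lambda>v. \<Sum>b\<in>Basis. frechet_derivative (\<lambda>y. frechet_derivative f (at y) b) (at x) v *\<^sub>R b)) (at x)"
    and "continuous_on S (\<lambda>x. \<Sum>b\<in>Basis.
      frechet_derivative (\<lambda>y. frechet_derivative f (at y) b) (at x) v *\<^sub>R b)"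
    and "continuous_on S (grad f)"
proof -
  have d: "dir_derivs vs f differentiable (at x)" if "length vs < 2" "x \<in> S" for vs x
    using assms that unfolding Ck_on_def by auto
  have c: "continuous_on S (dir_derivs vs f)" if "length vs \<le> 2" for vs
    using assms that unfolding Ck_on_def by auto
  have d0: "f differentiable (at x)" if "x \<in> S" for x using d[of "[]"] that by simp
  have d1: "(\<lambda>y. frechet_derivative f (at y) b) differentiable (at x)" if "x \<in> S" for x b
    using d[of "[b]"] that by simp
  show "(f has_derivative (\<lambda>v. grad f x \<bullet> v)) (at x)" if "x \<in> S"
    using d0[OF that] frechet_derivative_eq_grad[OF d0[OF that], abs_def] frechet_derivative_works[of f "at x"]
    by simp
  show "(grad f has_derivative
      (\<lambda>v. \<Sum>b\<in>Basis. frechet_derivative (\<lambda>y. frechet_derivative f (at y) b) (at x) v *\<^sub>R b)) (at x)"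
    if "x \<in> S"
    unfolding grad_def[abs_def]
    by (intro has_derivative_sum has_derivative_scaleR_left) (use d1[OF that] frechet_derivative_works in blast)
  show "continuous_on S (\<lambda>x. \<Sum>b\<in>Basis.
      frechet_derivative (\<lambda>y. frechet_derivative f (at y) b) (at x) v *\<^sub>R b)"
    \<comment> \<open>In \<open>[v, b]\<close> the derivative along \<open>b\<close> is taken first
      and the one along \<open>v\<close> second.\<close>
    using c[of "[v, b]" for b] by (intro continuous_intros) simp
  show "continuous_on S (grad f)"
    unfolding grad_def[abs_def] using c[of "[b]" for b] by (intro continuous_intros) simp
qed

lemma closure_grad_interior:
  assumes "open S" "continuous_on S (grad f)" "x \<in> S"
  shows "closure_grad S f x = grad f x"
  unfolding closure_grad_def at_within_open[OF assms(3,1)]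
  using assms by (intro tendsto_Lim) (auto simp: continuous_on_eq_continuous_at isCont_def)

text \<open>Each partial derivative extends continuously to the compact closure of \<open>S\<close>
  and is therefore bounded; the norm of the gradient is at most the sum of these bounds.\<close>

lemma Ck_closure_grad_bounded:
  fixes f :: "'a::euclidean_space \<Rightarrow> real"
  assumes "Ck_closure k S f" "1 \<le> k" "bounded S"
  obtains L where "\<And>x. x \<in> S \<Longrightarrow> norm (grad f x) \<le> L"
proof -
  have "\<exists>B. \<forall>x\<in>S. \<bar>frechet_derivative f (at x) b\<bar> \<le> B" for b
  proof -
    have "\<forall>vs. length vs \<le> k \<longrightarrow>
        (\<exists>g. continuous_on (closure S) g \<and> (\<forall>x\<in>S. g x = dir_derivs vs f x))"
      using assms(1) unfolding Ck_closure_def by blast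
    from this[rule_format, of "[b]"] assms(2) obtain g where
      g: "continuous_on (closure S) g" "\<forall>x\<in>S. g x = frechet_derivative f (at x) b" by auto
    have "compact (g ` closure S)"
      using g(1) assms(3) by (intro compact_continuous_image) auto
    then obtain B where "\<forall>y\<in>g ` closure S. norm y \<le> B"
      using compact_imp_bounded bounded_iff by blast
    then show ?thesis using g(2) closure_subset[of S] by (intro exI[of _ B]) force
  qed
  then obtain B where B: "\<And>b x. x \<in> S \<Longrightarrow> \<bar>frechet_derivative f (at x) b\<bar> \<le> B b" by metis
  have "norm (grad f x) \<le> (\<Sum>b\<in>Basis. B b)" if "x \<in> S" for x
    unfolding grad_def using B[OF that] by (intro order_trans[OF norm_sum] sum_mono) auto
  then show thesis by (rule that)
qed

section \<open>Comparison of Cheeger quotients and the contradiction\<close>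

text \<open>The self-Cheeger property bounds the quotient of \<open>\<Omega>\<close> by that of the
  competitor \<open>E\<close>. With positive finite volumes this becomes a real inequality after
  cross-multiplication, and for \<open>E\<close> an upper bound of the perimeter is enough.\<close>

lemma self_cheeger_le:
  assumes sc: "self_cheeger C \<Omega>" and E: "E \<subseteq> \<Omega>" "E \<in> sets lebesgue"
    and V: "emeasure lebesgue \<Omega> = ennreal V" "0 < V" and P: "rel_perimeter C \<Omega> = ereal P"
    and V': "emeasure lebesgue E = ennreal V'" "0 < V'" and P': "rel_perimeter C E \<le> ereal P'"
  shows "P * V' \<le> P' * V"
proof -
  have "ereal P / ereal V = cheeger_quotient C \<Omega>"
    unfolding cheeger_quotient_def P V(1) using V(2) by (simp add: enn2ereal_ennreal)
  also have "\<dots> \<le> cheeger_quotient C E"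
    using sc E V' unfolding self_cheeger_def rel_cheeger_constant_def by (auto intro!: INF_lower)
  also have "\<dots> \<le> ereal P' / ereal V'"
  proof -
    have "rel_perimeter C E / ereal V' \<le> ereal P' / ereal V'"
      using V'(2) by (intro ereal_divide_right_mono P') auto
    then show ?thesis
      unfolding cheeger_quotient_def V'(1) using V'(2) by (simp add: enn2ereal_ennreal)
  qed
  finally show ?thesis using V(2) V'(2) by (simp add: field_simps)
qed

lemma not_self_cheeger_subgraph:
  fixes \<omega> :: "'a::euclidean_space set" and \<phi> :: "'a \<Rightarrow> real"
  assumes op: "open \<omega>" and bd: "bounded \<omega>" and ne: "\<omega> \<noteq> {}"
    and C2: "Ck_closure 2 \<omega> \<phi>"
    and pos: "\<forall>x\<in>closure \<omega>. 0 < \<phi> x"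
    and \<delta>: "0 < \<delta>" "\<And>x. x \<in> \<omega> \<Longrightarrow> \<delta> \<le> norm (grad \<phi> x)"
  shows "\<not> self_cheeger (cylinder \<omega>) (subgraph \<omega> \<phi>)"
proof
  assume sc: "self_cheeger (cylinder \<omega>) (subgraph \<omega> \<phi>)"
  have Ck: "Ck_on 2 \<omega> \<phi>" and c\<phi>: "continuous_on (closure \<omega>) \<phi>"
    using C2 unfolding Ck_closure_def by auto
  note C = Ck_on_2_imp[OF Ck]
  define G where "G = grad \<phi>"
  obtain L where L: "\<And>x. x \<in> \<omega> \<Longrightarrow> norm (G x) \<le> L"
    unfolding G_def using Ck_closure_grad_bounded[OF C2 _ bd] by force
  have cpt: "compact (closure \<omega>)" and ne': "closure \<omega> \<noteq> {}" using bd ne by auto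
  obtain xm where "xm \<in> closure \<omega>" "\<forall>y\<in>closure \<omega>. \<phi> xm \<le> \<phi> y"
    using continuous_attains_inf[OF cpt ne' c\<phi>] by blast
  then obtain m where m: "0 < m" "\<And>x. x \<in> \<omega> \<Longrightarrow> m \<le> \<phi> x"
    using pos closure_subset[of \<omega>] by blast
  obtain xM where "xM \<in> closure \<omega>" "\<forall>y\<in>closure \<omega>. \<phi> y \<le> \<phi> xM"
    using continuous_attains_sup[OF cpt ne' c\<phi>] by blast
  then have bddM: "bdd_above (\<phi> ` \<omega>)"
    using closure_subset[of \<omega>] by (intro bdd_aboveI[of _ "\<phi> xM"]) auto
  \<comment> \<open>The supremum over the open set itself rather than over its closure, so that
    heights close to \<open>M\<close> are attained at points of \<open>\<omega>\<close>.\<close>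
  define M where "M = Sup (\<phi> ` \<omega>)"
  have \<phi>M: "\<phi> x \<le> M" if "x \<in> \<omega>" for x
    unfolding M_def using that bddM by (intro cSup_upper) auto
  interpret \<phi>: bounded_C1_graph \<omega> \<phi> G M L
    by unfold_locales (use op bd C(1,4) \<phi>M L in \<open>auto simp: G_def\<close>)
  have \<phi>0: "0 < \<phi> x" if "x \<in> \<omega>" for x using m that by force
  define P where "P = (LINT x|lborel. indicator \<omega> x * sqrt (1 + (norm (G x))\<^sup>2))"
  define A where "A = (LINT x|lborel. indicator \<omega> x * \<phi> x)"
  have perim: "rel_perimeter (cylinder \<omega>) (subgraph \<omega> \<phi>) = ereal P"
    unfolding P_def using \<phi>.rel_perimeter_subgraph_le \<phi>.rel_perimeter_subgraph_ge[OF \<phi>0 C(2,3)[folded G_def]]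
    by (intro antisym)
  have vol: "emeasure lebesgue (subgraph \<omega> \<phi>) = ennreal A" and iA: "integrable lborel (\<lambda>x. indicator \<omega> x * \<phi> x)"
    unfolding A_def using \<phi>.emeasure_subgraph \<phi>0 less_imp_le by blast+
  obtain x0 where x0: "x0 \<in> \<omega>" using ne by auto
  have A0: "0 < A"
    unfolding A_def by (rule \<phi>.integral_over_base_pos[OF \<phi>.cont_g iA _ x0]) (use \<phi>0 x0 less_imp_le in auto)
  have P0: "0 \<le> P" unfolding P_def by (intro Bochner_Integration.integral_nonneg) auto
  define c where "c = sqrt (1 + \<delta>\<^sup>2)"
  have c: "1 < c" unfolding c_def using \<delta>(1) by simp
  have cG: "c \<le> sqrt (1 + (norm (G x))\<^sup>2)" if "x \<in> \<omega>" for x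
    unfolding c_def G_def using \<delta>(1) \<delta>(2)[OF that] by (intro real_sqrt_le_mono add_left_mono power_mono) auto
  \<comment> \<open>The bound by \<open>m\<close> keeps the flattened function positive. The second
    term makes \<open>\<epsilon> * P\<close> smaller than \<open>(c - 1) * A\<close>; the summand 1
    in the denominator excludes division by zero and makes the inequality strict.\<close>
  define \<epsilon> where "\<epsilon> = min m ((c - 1) * A / (P + 1))"
  have \<epsilon>: "0 < \<epsilon>" "\<epsilon> \<le> m" "\<epsilon> * P < (c - 1) * A"
  proof -
    have 1: "0 < (c - 1) * A" using c A0 by simp
    then show e: "0 < \<epsilon>" unfolding \<epsilon>_def using m(1) P0 by simp
    show "\<epsilon> \<le> m" unfolding \<epsilon>_def by simp
    have "\<epsilon> * (P + 1) \<le> (c - 1) * A / (P + 1) * (P + 1)"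
      unfolding \<epsilon>_def using P0 by (intro mult_right_mono) auto
    also have "\<dots> = (c - 1) * A" using P0 by simp
    finally show "\<epsilon> * P < (c - 1) * A" using e by (simp add: distrib_left)
  qed
  define l where "l x = max 0 (\<phi> x - (M - \<epsilon>)) / \<epsilon>" for x
  define g where "g x = \<phi> x - (max 0 (\<phi> x - (M - \<epsilon>)))\<^sup>2 / (2 * \<epsilon>)" for x
  have l: "0 \<le> l x" "l x \<le> 1" if "x \<in> \<omega>" for x
    unfolding l_def using \<epsilon>(1) \<phi>M[OF that] by auto
  have g_eq: "g x = \<phi> x - \<epsilon> / 2 * (l x)\<^sup>2" for x
    unfolding g_def l_def using \<epsilon>(1) by (simp add: power_divide power2_eq_square)
  have cl: "continuous_on \<omega> l"
    unfolding l_def using \<epsilon>(1) by (intro continuous_intros \<phi>.cont_g) auto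
  have g': "(g has_derivative (\<lambda>v. ((1 - l x) *\<^sub>R G x) \<bullet> v)) (at x)" if "x \<in> \<omega>" for x
  proof -
    have "((\<lambda>x. \<phi> x - (M - \<epsilon>)) has_derivative (\<lambda>v. G x \<bullet> v)) (at x)"
      by (auto intro!: derivative_eq_intros \<phi>.g' that)
    from has_derivative_compose[OF this DERIV_pos_part_square[unfolded has_field_derivative_def]]
    have "((\<lambda>x. (max 0 (\<phi> x - (M - \<epsilon>)))\<^sup>2) has_derivative (\<lambda>v. 2 * max 0 (\<phi> x - (M - \<epsilon>)) * (G x \<bullet> v))) (at x)" .
    \<comment> \<open>The factor \<open>2 * max 0 (\<phi> x - (M - \<epsilon>)) * inverse (2 *
      \<epsilon>)\<close> is \<open>l x\<close>, whence the gradient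
      \<open>(1 - l x) *\<^sub>R G x\<close>.\<close>
    from has_derivative_diff[OF \<phi>.g'[OF that] has_derivative_mult_left[OF this, of "inverse (2 * \<epsilon>)"]]
    have "(g has_derivative (\<lambda>v. G x \<bullet> v - 2 * max 0 (\<phi> x - (M - \<epsilon>)) * (G x \<bullet> v) * inverse (2 * \<epsilon>))) (at x)"
      unfolding g_def divide_inverse .
    then show ?thesis
      unfolding l_def using \<epsilon>(1) by (simp add: inner_diff_left field_simps)
  qed
  have g\<phi>: "g x \<le> \<phi> x" for x unfolding g_eq using \<epsilon>(1) by simp
  have l2: "(l x)\<^sup>2 \<le> l x" if "x \<in> \<omega>" for x
    using l[OF that] by (simp add: power2_eq_square mult_left_le)
  have gl: "\<phi> x - \<epsilon> / 2 * l x \<le> g x" if "x \<in> \<omega>" for x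
    unfolding g_eq using mult_left_mono[OF l2[OF that], of "\<epsilon> / 2"] \<epsilon>(1) by simp
  have g0: "0 < g x" if "x \<in> \<omega>" for x
  proof -
    have "\<epsilon> / 2 * l x \<le> \<epsilon> / 2 * 1" using l[OF that] \<epsilon>(1) by (intro mult_left_mono) auto
    then show ?thesis using gl[OF that] m(2)[OF that] \<epsilon>(1,2) by linarith
  qed
  interpret g: bounded_C1_graph \<omega> g "\<lambda>x. (1 - l x) *\<^sub>R G x" M L
  proof
    show "g x \<le> M" if "x \<in> \<omega>" for x using g\<phi>[of x] \<phi>M[OF that] by linarith
    show "norm ((1 - l x) *\<^sub>R G x) \<le> L" if "x \<in> \<omega>" for x
    proof -
      have "\<bar>1 - l x\<bar> * norm (G x) \<le> 1 * norm (G x)" using l[OF that] by (intro mult_right_mono) auto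
      then show ?thesis using L[OF that] by simp
    qed
  qed (use op bd g' in \<open>auto intro!: continuous_intros cl \<phi>.contG\<close>)
  define \<Lambda> where "\<Lambda> = (LINT x|lborel. indicator \<omega> x * l x)"
  define V where "V = (LINT x|lborel. indicator \<omega> x * g x)"
  have il: "integrable lborel (\<lambda>x. indicator \<omega> x * l x)"
    by (rule \<phi>.integrable_over_base[OF cl, of 1]) (use l in auto)
  \<comment> \<open>A point of \<open>\<omega>\<close> where \<open>l\<close> is positive, which
    makes \<open>\<Lambda>\<close> positive.\<close>
  obtain y where y: "y \<in> \<omega>" "M - \<epsilon> < \<phi> y"
    using less_cSup_iff[of "\<phi> ` \<omega>" "M - \<epsilon>"] ne bddM \<epsilon>(1) unfolding M_def by auto
  have \<Lambda>0: "0 < \<Lambda>"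
    unfolding \<Lambda>_def by (rule \<phi>.integral_over_base_pos[OF cl il _ y(1)]) (use l y(2) \<epsilon>(1) in \<open>auto simp: l_def\<close>)
  have iV: "integrable lborel (\<lambda>x. indicator \<omega> x * g x)"
    and V: "emeasure lebesgue (subgraph \<omega> g) = ennreal V"
    unfolding V_def using g.emeasure_subgraph g0 less_imp_le by blast+
  have V0: "0 < V"
    unfolding V_def by (rule \<phi>.integral_over_base_pos[OF g.cont_g iV _ x0]) (use g0 x0 less_imp_le in auto)
  \<comment> \<open>Since \<open>l\<close> takes values between 0 and 1, its square is at most
    \<open>l\<close>, so both the loss of volume and the gain of perimeter are measured by
    \<open>\<Lambda>\<close>.\<close>
  have VA: "A - \<epsilon> / 2 * \<Lambda> \<le> V"
  proof -
    have "A - \<epsilon> / 2 * \<Lambda> = (LINT x|lborel. indicator \<omega> x * \<phi> x - \<epsilon> / 2 * (indicator \<omega> x * l x))"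
      unfolding A_def \<Lambda>_def using iA il by simp
    also have "\<dots> \<le> V"
      unfolding V_def using iA il iV gl by (intro integral_mono) (auto simp: indicator_def)
    finally show ?thesis .
  qed
  have "rel_perimeter (cylinder \<omega>) (subgraph \<omega> g) \<le> ereal (P - (c - 1) * \<Lambda>)"
  proof (rule order_trans[OF g.rel_perimeter_subgraph_le])
    have "(LINT x|lborel. indicator \<omega> x * sqrt (1 + (norm ((1 - l x) *\<^sub>R G x))\<^sup>2))
      \<le> (LINT x|lborel. indicator \<omega> x * sqrt (1 + (norm (G x))\<^sup>2) - (c - 1) * (indicator \<omega> x * l x))"
    proof (rule integral_mono[OF g.integrable_area_factor])
      show "integrable lborel (\<lambda>x. indicator \<omega> x * sqrt (1 + (norm (G x))\<^sup>2) - (c - 1) * (indicator \<omega> x * l x))"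
        using \<phi>.integrable_area_factor il by simp
      fix x
      show "indicator \<omega> x * sqrt (1 + (norm ((1 - l x) *\<^sub>R G x))\<^sup>2)
        \<le> indicator \<omega> x * sqrt (1 + (norm (G x))\<^sup>2) - (c - 1) * (indicator \<omega> x * l x)"
        \<comment> \<open>Convexity with \<open>p = norm (G x)\<close> and the flattening weight
          \<open>l x\<close>.\<close>
        using sqrt_area_factor_convex[OF l cG, of x x]
        by (cases "x \<in> \<omega>") (auto simp: mult.commute power_mult_distrib)
    qed
    also have "\<dots> = P - (c - 1) * \<Lambda>"
      unfolding P_def \<Lambda>_def using \<phi>.integrable_area_factor il by simp
    finally show "ereal (LINT x|lborel. indicator \<omega> x * sqrt (1 + (norm ((1 - l x) *\<^sub>R G x))\<^sup>2))
      \<le> ereal (P - (c - 1) * \<Lambda>)" by simp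
  qed
  moreover have "subgraph \<omega> g \<subseteq> subgraph \<omega> \<phi>"
    unfolding subgraph_def using g\<phi> by (auto intro: less_le_trans)
  moreover have "subgraph \<omega> g \<in> sets lebesgue" using g.open_subgraph by auto
  ultimately have "P * V \<le> (P - (c - 1) * \<Lambda>) * A"
    using sc vol A0 perim V V0 by (intro self_cheeger_le)
  moreover have "P * (A - \<epsilon> / 2 * \<Lambda>) \<le> P * V" using VA P0 by (intro mult_left_mono)
  \<comment> \<open>The common term \<open>P * A\<close> cancels. What remains is linear in
    \<open>\<Lambda>\<close>, which is positive and can be divided out, contradicting the choice of
    \<open>\<epsilon>\<close>.\<close>
  ultimately have "((c - 1) * A) * \<Lambda> \<le> (\<epsilon> * P / 2) * \<Lambda>" by (simp add: algebra_simps)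
  then have "(c - 1) * A \<le> \<epsilon> * P / 2" using \<Lambda>0 by (simp only: mult_le_cancel_right_pos)
  moreover have "0 \<le> \<epsilon> * P" using \<epsilon>(1) P0 by simp
  ultimately show False using \<epsilon>(3) by linarith
qed

theorem theorem3p8:
  fixes \<omega> :: "(real ^ 'n) set"
    and \<phi> :: "real ^ 'n \<Rightarrow> real"
    and \<delta> :: real
  assumes "smooth_bounded_domain \<omega>"
    and "Ck_closure 2 \<omega> \<phi>"
    and "\<forall>x\<in>closure \<omega>. 0 < \<phi> x"
    and "0 < \<delta>"
    and "\<forall>x\<in>closure \<omega>. \<delta> \<le> norm (closure_grad \<omega> \<phi> x)"
  shows "\<not> self_cheeger (cylinder \<omega>) (subgraph \<omega> \<phi>)"
proof -
  have op: "open \<omega>" and bd: "bounded \<omega>" and ne: "\<omega> \<noteq> {}"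
    using assms(1) unfolding smooth_bounded_domain_def by auto
  have "Ck_on 2 \<omega> \<phi>" using assms(2) unfolding Ck_closure_def by auto
  then have "continuous_on \<omega> (grad \<phi>)" by (rule Ck_on_2_imp(4))
  \<comment> \<open>At points of the open set the gradient is continuous, so its extension to the
    closure has the same value there.\<close>
  then have "\<delta> \<le> norm (grad \<phi> x)" if "x \<in> \<omega>" for x
    using assms(5) closure_subset[of \<omega>] closure_grad_interior[OF op _ that] that by force
  then show ?thesis
    by (rule not_self_cheeger_subgraph[OF op bd ne assms(2-4)])
qed
end
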